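(* Let $k$ be a field, let $Q$ be a finite connected quiver, and let $A=kQ/\langle Z\rangle$ be a finite-dimensional monomial algebra. If $\mathrm{char}\,k\neq 2$, then $\mathrm{Alt}(DA)=0$ if and only if the involution of the set $\mathcal N$ of neat equivalence classes induced by the flip of pairs $(\alpha,\beta)\mapsto(\beta,\alpha)$ is the identity. If $\mathrm{char}\,k=2$, then $\mathrm{Alt}(DA)=0$ if and only if the set of neat cyclic pairs is empty.
   Context: Quiver: vertices $Q_0$, arrows $Q_1$, source and terminal maps $s,t$. A path of length $l\ge 1$ is a sequence $a_l\cdots a_1$ of arrows with $t(a_i)=s(a_{i+1})$; its first arrow is $a_1$, its last arrow is $a_l$, its source is $s(a_1)$, its terminal vertex is $t(a_l)$. Vertices are the (trivial) paths of length $0$. The product in $kQ$ is concatenation. $Z$ is a set of paths of length at least two, minimal for the subpath order (no strict subpath of an element of $Z$ is in $Z$), and $A=kQ/\langle Z\rangle$, where $\langle Z\rangle$ is the two-sided ideal generated by $Z$. $B$ is the set of paths (including vertices) containing no path of $Z$ as a subpath; it is identified with a $k$-basis of $A$. $DA=\mathrm{Hom}_k(A,k)$ is the dual $A$-$A$-bimodule, $(afb)(x)=f(bxa)$. For $\varphi\in\mathrm{Hom}_{A-A}(DA,A)$ (bimodule morphisms), $\varphi^*:DA\to DDA\cong A$ is the transpose. $\mathrm{Alt}(DA)=\{\varphi\in \mathrm{Hom}_{A-A}(DA,A):\varphi+\varphi^*=0\}$. $B\odot B=\{(\alpha,\beta)\in B\times B: t(\beta)=s(\alpha),\ t(\alpha)=s(\beta)\}$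 is the set of cyclic pairs. A cyclic pair $(\alpha,\beta)\in B\odot B$ is neat if for all arrows $a,b\in Q_1$: (i) if $\beta a\in B$ then $a$ is the last arrow of $\alpha$, and if $a\beta\in B$ then $a$ is the first arrow of $\alpha$; (ii) if $\alpha b\in B$ then $b$ is the last arrow of $\beta$, and if $b\alpha\in B$ then $b$ is the first arrow of $\beta$. (Here "$\beta a\in B$" includes that $\beta a$ is a path.) Let $\sim$ be the equivalence relation on $B\odot B$ generated by $(a\alpha,\beta)\sim(\alpha,\beta a)$ and $(\alpha b,\beta)\sim(\alpha,b\beta)$ with $a,b\in Q_1$ (both pairs in $B\odot B$). An equivalence class is neat if all its elements are neat cyclic pairs; $\mathcal N$ is the set of neat equivalence classes. The flip of pairs preserves neatness and is compatible with $\sim$, hence induces an involution of $\mathcal N$.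
   Formalization: In characteristic 2, "the set of neat cyclic pairs is empty" is replaced by "the set N of neat equivalence classes is empty"; the original fails for a:1→2, b,c:2→1, Z={aba,ca}, where (ab,ab) is a neat pair but no class is neat and Alt(DA)=0. *)

theory Defs
  imports
    "Graph_Theory.Arc_Walk"
    "Graph_Theory.Digraph_Component"
    "HOL-Algebra.QuotRing"
    "HOL-Algebra.Module"
begin

section \<open>Paths of a quiver\<close>

text \<open>
  A quiver is a \<^typ>\<open>('v, 'e) pre_digraph\<close>, with source map \<^const>\<open>tail\<close> and terminal map
  \<^const>\<open>head\<close>. The path $a_l\cdots a_1$ is the triple of its source, the list
  $[a_1,\dots,a_l]$ of its arrows in the order of traversal, and its terminal vertex; so its first
  arrow is the head of the list. The vertex $v$ is the path \<open>(v, [], v)\<close>.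
\<close>

type_synonym ('v, 'e) qpath = "'v \<times> 'e list \<times> 'v"

fun psrc :: "('v, 'e) qpath \<Rightarrow> 'v" where
  "psrc (u, w, v) = u"

fun parrows :: "('v, 'e) qpath \<Rightarrow> 'e list" where
  "parrows (u, w, v) = w"

fun ptgt :: "('v, 'e) qpath \<Rightarrow> 'v" where
  "ptgt (u, w, v) = v"

definition qpaths :: "('v, 'e) pre_digraph \<Rightarrow> ('v, 'e) qpath set" where
  "qpaths Q = {(u, w, v). pre_digraph.awalk Q u w v}"

definition arrow :: "('v, 'e) pre_digraph \<Rightarrow> 'e \<Rightarrow> ('v, 'e) qpath" where
  "arrow Q a = (tail Q a, [a], head Q a)"

text \<open>The concatenation $pq$ traverses $q$ first; it is meaningful only for composable paths.\<close>

definition composable :: "('v, 'e) qpath \<Rightarrow> ('v, 'e) qpath \<Rightarrow> bool" where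
  "composable p q \<longleftrightarrow> ptgt q = psrc p"

definition pconc :: "('v, 'e) qpath \<Rightarrow> ('v, 'e) qpath \<Rightarrow> ('v, 'e) qpath" (infixl \<open>\<cdot>\<close> 75) where
  "p \<cdot> q = (psrc q, parrows q @ parrows p, ptgt p)"

definition subpath :: "('v, 'e) pre_digraph \<Rightarrow> ('v, 'e) qpath \<Rightarrow> ('v, 'e) qpath \<Rightarrow> bool" where
  "subpath Q z p \<longleftrightarrow> (\<exists>x\<in>qpaths Q. \<exists>y\<in>qpaths Q.
      composable x z \<and> composable z y \<and> p = x \<cdot> z \<cdot> y)"

definition monomial_relations :: "('v, 'e) pre_digraph \<Rightarrow> ('v, 'e) qpath set \<Rightarrow> bool" where
  "monomial_relations Q Z \<longleftrightarrow> Z \<subseteq> qpaths Q \<and> (\<forall>z\<in>Z. 2 \<le> length (parrows z)) \<and>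
     (\<forall>z\<in>Z. \<forall>y\<in>Z. subpath Q y z \<longrightarrow> y = z)"

definition basis_paths ::
    "('v, 'e) pre_digraph \<Rightarrow> ('v, 'e) qpath set \<Rightarrow> ('v, 'e) qpath set" where
  "basis_paths Q Z = {p \<in> qpaths Q. \<forall>z\<in>Z. \<not> subpath Q z p}"


section \<open>The path algebra and its monomial quotients\<close>

text \<open>
  The elements of $kQ$ are the finitely supported coefficient functions on paths. The unit is the
  sum of the vertices, so it lies in the carrier only if the quiver has finitely many vertices.
\<close>

definition path_algebra ::
    "('v, 'e) pre_digraph \<Rightarrow> ('k::field, ('v, 'e) qpath \<Rightarrow> 'k) module" where
  "path_algebra Q =
    \<lparr>carrier = {x. finite {p. x p \<noteq> 0} \<and> {p. x p \<noteq> 0} \<subseteq> qpaths Q},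
     mult = (\<lambda>x y r. \<Sum>(p, q) \<in> {(p, q). p \<in> qpaths Q \<and> q \<in> qpaths Q \<and> composable p q \<and> p \<cdot> q = r}.
       x p * y q),
     one = (\<lambda>p. if p \<in> qpaths Q \<and> parrows p = [] then 1 else 0),
     zero = (\<lambda>p. 0),
     add = (\<lambda>x y p. x p + y p),
     smult = (\<lambda>c x p. c * x p)\<rparr>"

definition path_element :: "('v, 'e) qpath \<Rightarrow> ('v, 'e) qpath \<Rightarrow> 'k::field" where
  "path_element p = (\<lambda>q. if q = p then 1 else 0)"

definition quotient_algebra :: "('k, 'm) module \<Rightarrow> 'm set \<Rightarrow> ('k, 'm set) module" where
  "quotient_algebra R I = ring.extend (R Quot I)
     (module.fields (\<lambda>c X. \<Union>x\<in>X. I +>\<^bsub>R\<^esub> (c \<odot>\<^bsub>R\<^esub> x)))"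

definition monomial_algebra ::
    "('v, 'e) pre_digraph \<Rightarrow> ('v, 'e) qpath set \<Rightarrow>
      ('k::field, (('v, 'e) qpath \<Rightarrow> 'k) set) module" where
  "monomial_algebra Q Z =
     quotient_algebra (path_algebra Q) (Idl\<^bsub>path_algebra Q\<^esub> (path_element ` Z))"


section \<open>Bimodule morphisms from the dual, and alternating ones\<close>

definition finite_dimensional :: "('k, 'm) module \<Rightarrow> bool" where
  "finite_dimensional A \<longleftrightarrow> (\<exists>S. finite S \<and> S \<subseteq> carrier A \<and>
     (\<forall>x\<in>carrier A. \<exists>c. x = (\<Oplus>\<^bsub>A\<^esub>s\<in>S. c s \<odot>\<^bsub>A\<^esub> s)))"

definition dual :: "('k::field, 'm) module \<Rightarrow> ('m \<Rightarrow> 'k) set" where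
  "dual A = {f \<in> extensional (carrier A).
     (\<forall>x\<in>carrier A. \<forall>y\<in>carrier A. f (x \<oplus>\<^bsub>A\<^esub> y) = f x + f y) \<and>
     (\<forall>c. \<forall>x\<in>carrier A. f (c \<odot>\<^bsub>A\<^esub> x) = c * f x)}"

definition dual_add :: "('k::field, 'm) module \<Rightarrow> ('m \<Rightarrow> 'k) \<Rightarrow> ('m \<Rightarrow> 'k) \<Rightarrow> 'm \<Rightarrow> 'k" where
  "dual_add A f g = (\<lambda>x\<in>carrier A. f x + g x)"

definition dual_act :: "('k::field, 'm) module \<Rightarrow> 'm \<Rightarrow> ('m \<Rightarrow> 'k) \<Rightarrow> 'm \<Rightarrow> 'm \<Rightarrow> 'k" where
  "dual_act A a f b = (\<lambda>x\<in>carrier A. f (b \<otimes>\<^bsub>A\<^esub> x \<otimes>\<^bsub>A\<^esub> a))"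

text \<open>Linearity over $k$ is the compatibility with the action of the elements $c\cdot 1$ of $A$.\<close>

definition bimodule_homs :: "('k::field, 'm) module \<Rightarrow> (('m \<Rightarrow> 'k) \<Rightarrow> 'm) set" where
  "bimodule_homs A = {\<phi> \<in> dual A \<rightarrow>\<^sub>E carrier A.
     (\<forall>f\<in>dual A. \<forall>g\<in>dual A. \<phi> (dual_add A f g) = \<phi> f \<oplus>\<^bsub>A\<^esub> \<phi> g) \<and>
     (\<forall>a\<in>carrier A. \<forall>f\<in>dual A. \<forall>b\<in>carrier A.
        \<phi> (dual_act A a f b) = a \<otimes>\<^bsub>A\<^esub> \<phi> f \<otimes>\<^bsub>A\<^esub> b)}"

definition bidual_map :: "('k::field, 'm) module \<Rightarrow> 'm \<Rightarrow> ('m \<Rightarrow> 'k) \<Rightarrow> 'k" where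
  "bidual_map A a = (\<lambda>f\<in>dual A. f a)"

text \<open>
  The inverse of \<^const>\<open>bidual_map\<close> is the identification $DDA\cong A$; it is meaningful because
  \<^const>\<open>bidual_map\<close> is bijective onto $DDA$ for finite-dimensional $A$.
\<close>

definition bimodule_transpose ::
    "('k::field, 'm) module \<Rightarrow> (('m \<Rightarrow> 'k) \<Rightarrow> 'm) \<Rightarrow> ('m \<Rightarrow> 'k) \<Rightarrow> 'm" where
  "bimodule_transpose A \<phi> = (\<lambda>f\<in>dual A. inv_into (carrier A) (bidual_map A) (\<lambda>g\<in>dual A. f (\<phi> g)))"

definition Alt :: "('k::field, 'm) module \<Rightarrow> (('m \<Rightarrow> 'k) \<Rightarrow> 'm) set" where
  "Alt A = {\<phi> \<in> bimodule_homs A. \<forall>f\<in>dual A. \<phi> f \<oplus>\<^bsub>A\<^esub> bimodule_transpose A \<phi> f = \<zero>\<^bsub>A\<^esub>}"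

definition zero_hom :: "('k::field, 'm) module \<Rightarrow> ('m \<Rightarrow> 'k) \<Rightarrow> 'm" where
  "zero_hom A = (\<lambda>f\<in>dual A. \<zero>\<^bsub>A\<^esub>)"


section \<open>Neat cyclic pairs\<close>

definition cyclic_pairs ::
    "('v, 'e) pre_digraph \<Rightarrow> ('v, 'e) qpath set \<Rightarrow> (('v, 'e) qpath \<times> ('v, 'e) qpath) set" where
  "cyclic_pairs Q Z = {(\<alpha>, \<beta>) \<in> basis_paths Q Z \<times> basis_paths Q Z.
     ptgt \<beta> = psrc \<alpha> \<and> ptgt \<alpha> = psrc \<beta>}"

text \<open>A trivial path has neither a first nor a last arrow.\<close>

definition is_first_arrow :: "'e \<Rightarrow> ('v, 'e) qpath \<Rightarrow> bool" where
  "is_first_arrow a p \<longleftrightarrow> parrows p \<noteq> [] \<and> hd (parrows p) = a"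

definition is_last_arrow :: "'e \<Rightarrow> ('v, 'e) qpath \<Rightarrow> bool" where
  "is_last_arrow a p \<longleftrightarrow> parrows p \<noteq> [] \<and> last (parrows p) = a"

definition neat_pair ::
    "('v, 'e) pre_digraph \<Rightarrow> ('v, 'e) qpath set \<Rightarrow> ('v, 'e) qpath \<times> ('v, 'e) qpath \<Rightarrow> bool" where
  "neat_pair Q Z = (\<lambda>(\<alpha>, \<beta>). (\<alpha>, \<beta>) \<in> cyclic_pairs Q Z \<and>
     (\<forall>a\<in>arcs Q.
        (composable \<beta> (arrow Q a) \<and> \<beta> \<cdot> arrow Q a \<in> basis_paths Q Z \<longrightarrow> is_last_arrow a \<alpha>) \<and>
        (composable (arrow Q a) \<beta> \<and> arrow Q a \<cdot> \<beta> \<in> basis_paths Q Z \<longrightarrow> is_first_arrow a \<alpha>)) \<and>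
     (\<forall>b\<in>arcs Q.
        (composable \<alpha> (arrow Q b) \<and> \<alpha> \<cdot> arrow Q b \<in> basis_paths Q Z \<longrightarrow> is_last_arrow b \<beta>) \<and>
        (composable (arrow Q b) \<alpha> \<and> arrow Q b \<cdot> \<alpha> \<in> basis_paths Q Z \<longrightarrow> is_first_arrow b \<beta>)))"

inductive shift ::
    "('v, 'e) pre_digraph \<Rightarrow> ('v, 'e) qpath set \<Rightarrow>
      ('v, 'e) qpath \<times> ('v, 'e) qpath \<Rightarrow> ('v, 'e) qpath \<times> ('v, 'e) qpath \<Rightarrow> bool"
  for Q Z where
  "\<lbrakk>a \<in> arcs Q; composable (arrow Q a) \<alpha>; composable \<beta> (arrow Q a);
    (arrow Q a \<cdot> \<alpha>, \<beta>) \<in> cyclic_pairs Q Z; (\<alpha>, \<beta> \<cdot> arrow Q a) \<in> cyclic_pairs Q Z\<rbrakk>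
   \<Longrightarrow> shift Q Z (arrow Q a \<cdot> \<alpha>, \<beta>) (\<alpha>, \<beta> \<cdot> arrow Q a)"
| "\<lbrakk>b \<in> arcs Q; composable \<alpha> (arrow Q b); composable (arrow Q b) \<beta>;
    (\<alpha> \<cdot> arrow Q b, \<beta>) \<in> cyclic_pairs Q Z; (\<alpha>, arrow Q b \<cdot> \<beta>) \<in> cyclic_pairs Q Z\<rbrakk>
   \<Longrightarrow> shift Q Z (\<alpha> \<cdot> arrow Q b, \<beta>) (\<alpha>, arrow Q b \<cdot> \<beta>)"

definition cyclic_equiv ::
    "('v, 'e) pre_digraph \<Rightarrow> ('v, 'e) qpath set \<Rightarrow>
      ((('v, 'e) qpath \<times> ('v, 'e) qpath) \<times> (('v, 'e) qpath \<times> ('v, 'e) qpath)) set" where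
  "cyclic_equiv Q Z =
     {(x, y). x \<in> cyclic_pairs Q Z \<and> y \<in> cyclic_pairs Q Z \<and> equivclp (shift Q Z) x y}"

text \<open>
  The class of a neat pair need not be neat. With arrows $a : 1\to 2$ and $b, c : 2\to 1$ and
  $Z = \{aba, ca\}$, the pair $(ab, ab)$ is neat, but it is equivalent to $(a, bab)$, which is not
  neat because $ac\in B$; here no class is neat and $\mathrm{Hom}_{A-A}(DA, A) = 0$.
\<close>

definition neat_classes ::
    "('v, 'e) pre_digraph \<Rightarrow> ('v, 'e) qpath set \<Rightarrow> (('v, 'e) qpath \<times> ('v, 'e) qpath) set set" where
  "neat_classes Q Z = {C \<in> cyclic_pairs Q Z // cyclic_equiv Q Z. \<forall>x\<in>C. neat_pair Q Z x}"

text \<open>Since the flip respects the equivalence relation, the image of a class is a class.\<close>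

definition flip_class ::
    "(('v, 'e) qpath \<times> ('v, 'e) qpath) set \<Rightarrow> (('v, 'e) qpath \<times> ('v, 'e) qpath) set" where
  "flip_class C = prod.swap ` C"

end

theory Submission
  imports Defs
begin

text \<open>
  On the basis of paths, a linear map $DA \to A$ is a square matrix $c$ indexed by $B$, with
  $\varphi(\beta^*) = \sum_\alpha c(\alpha,\beta)\,\alpha$, and transposing $\varphi$ transposes $c$.
  Equivariance under a path $q$ on the left says that $c(q\gamma,\beta) = c(\gamma,\beta q)$, and that
  $c(\alpha,\beta) = 0$ whenever $\beta q \in B$ and $\alpha$ does not end with $q$, and whenever
  $q\alpha \in B$ and $\beta$ does not begin with $q$. Equivariance on the right is the same condition
  for the transposed matrix, so it comes for free when $c$ is antisymmetric. For vertices and arrows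
  these conditions say that $c$ is supported on neat cyclic pairs and constant on equivalence classes.
  Hence $\mathrm{Alt}(DA)$ is the space of functions $c$ on the neat classes with
  $c(C) + c(\overline{C}) = 0$, where $\overline{C}$ is the flip of $C$: a class with
  $\overline{C} \neq C$ contributes $[C] - [\overline{C}]$, and one with $\overline{C} = C$ contributes
  $[C]$ exactly in characteristic $2$.
\<close>

section \<open>Bimodule morphisms as matrices\<close>

text \<open>All matrix conditions come from one computation. Since (qf)(x) = f(xq), the left action
  of q sends the functional dual to a path \<delta> to the sum of the functionals dual to those
  \<beta> with \<beta>q = \<delta>. Cancellation of paths leaves at most one such \<beta>, so every
  equivariance equation compares single entries of c, and an entry must vanish when only one side
  factors through q. Neatness records this for arrows alone; longer q follow because balance for two
  composable paths gives balance for their product, which rests on factors of basis paths being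
  basis paths. The same closure under factors identifies the ideal generated by Z with the functions
  vanishing on B, and so yields coordinates on the cosets that make up A. The linear algebra is done
  for any algebra with finitely many coordinates and structure constants \<open>N\<close>, without
  mention of paths. A nonzero entry is carried to every pair of its class, which is why entire
  classes have to be neat.\<close>

locale based_algebra = ring A for A :: "('k::field, 'm) module" (structure) +
  fixes B :: "'b set" and coord :: "'m \<Rightarrow> 'b \<Rightarrow> 'k" and N :: "'b \<Rightarrow> 'b \<Rightarrow> 'b \<Rightarrow> 'k"
  assumes finite_basis: "finite B"
    and smult_closed [simp, intro]: "X \<in> carrier A \<Longrightarrow> c \<odot> X \<in> carrier A"
    and coord_add: "\<lbrakk>X \<in> carrier A; Y \<in> carrier A; p \<in> B\<rbrakk> \<Longrightarrow> coord (X \<oplus> Y) p = coord X p + coord Y p"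
    and coord_smult: "\<lbrakk>X \<in> carrier A; p \<in> B\<rbrakk> \<Longrightarrow> coord (c \<odot> X) p = c * coord X p"
    and coord_mult: "\<lbrakk>X \<in> carrier A; Y \<in> carrier A; r \<in> B\<rbrakk> \<Longrightarrow>
      coord (X \<otimes> Y) r = (\<Sum>p\<in>B. \<Sum>q\<in>B. N p q r * coord X p * coord Y q)"
    and coord_eqI: "\<lbrakk>X \<in> carrier A; Y \<in> carrier A; \<And>p. p \<in> B \<Longrightarrow> coord X p = coord Y p\<rbrakk> \<Longrightarrow> X = Y"
    and coord_surj: "\<exists>X\<in>carrier A. \<forall>p\<in>B. coord X p = h p"
begin

definition elem :: "('b \<Rightarrow> 'k) \<Rightarrow> 'm" where
  "elem h = (SOME X. X \<in> carrier A \<and> (\<forall>p\<in>B. coord X p = h p))"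

definition basis_elem :: "'b \<Rightarrow> 'm" where
  "basis_elem p = elem (\<lambda>q. of_bool (q = p))"

definition functional :: "('b \<Rightarrow> 'k) \<Rightarrow> 'm \<Rightarrow> 'k" where
  "functional h = (\<lambda>X\<in>carrier A. \<Sum>p\<in>B. h p * coord X p)"

definition hom_of :: "('b \<Rightarrow> 'b \<Rightarrow> 'k) \<Rightarrow> ('m \<Rightarrow> 'k) \<Rightarrow> 'm" where
  "hom_of c = (\<lambda>f\<in>dual A. elem (\<lambda>\<alpha>. \<Sum>\<beta>\<in>B. c \<alpha> \<beta> * f (basis_elem \<beta>)))"

text \<open>Coefficient of \<alpha> in the equivariance equation for \<open>q\<close> acting on the
  left of the functional dual to \<delta>: that functional takes the value
  \<open>N \<beta> q \<delta>\<close> at \<beta> after the action.\<close>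

definition balanced :: "('b \<Rightarrow> 'b \<Rightarrow> 'k) \<Rightarrow> 'b \<Rightarrow> bool" where
  "balanced c q \<longleftrightarrow> (\<forall>\<alpha>\<in>B. \<forall>\<delta>\<in>B. (\<Sum>\<beta>\<in>B. N \<beta> q \<delta> * c \<alpha> \<beta>) = (\<Sum>\<gamma>\<in>B. N q \<gamma> \<alpha> * c \<gamma> \<delta>))"

lemma elem: "elem h \<in> carrier A \<and> (\<forall>p\<in>B. coord (elem h) p = h p)"
  unfolding elem_def by (rule someI_ex) (use coord_surj[of h] in blast)

lemma elem_closed [simp, intro]: "elem h \<in> carrier A"
  and coord_elem [simp]: "p \<in> B \<Longrightarrow> coord (elem h) p = h p"
  using elem by auto

lemma basis_elem_closed [simp, intro]: "basis_elem p \<in> carrier A"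
  and coord_basis_elem [simp]: "q \<in> B \<Longrightarrow> coord (basis_elem p) q = of_bool (q = p)"
  by (auto simp: basis_elem_def)

lemma coord_zero [simp]: "p \<in> B \<Longrightarrow> coord \<zero> p = 0"
  using coord_add[of \<zero> \<zero> p] by (metis add_cancel_right_right l_zero zero_closed)

lemma sum_basis_delta [simp]:
  fixes F :: "'b \<Rightarrow> 'k"
  assumes "p \<in> B"
  shows "(\<Sum>q\<in>B. of_bool (q = p) * F q) = F p" and "(\<Sum>q\<in>B. F q * of_bool (q = p)) = F p"
    and "(\<Sum>q\<in>B. of_bool (p = q) * F q) = F p" and "(\<Sum>q\<in>B. F q * of_bool (p = q)) = F p"
  using assms finite_basis by (simp_all add: of_bool_def if_distrib if_distribR cong: if_cong)

text \<open>The locale does not assume compatibility of scalars with products; the bilinear formula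
  \<open>coord_mult\<close> forces it.\<close>

lemma smult_mult_left:
  "\<lbrakk>X \<in> carrier A; Y \<in> carrier A\<rbrakk> \<Longrightarrow> (c \<odot> X) \<otimes> Y = c \<odot> (X \<otimes> Y)"
  by (rule coord_eqI) (auto simp: coord_mult coord_smult sum_distrib_left ac_simps intro!: sum.cong)

lemma smult_mult_right:
  "\<lbrakk>X \<in> carrier A; Y \<in> carrier A\<rbrakk> \<Longrightarrow> X \<otimes> (c \<odot> Y) = c \<odot> (X \<otimes> Y)"
  by (rule coord_eqI) (auto simp: coord_mult coord_smult sum_distrib_left ac_simps intro!: sum.cong)

lemma
  assumes "f \<in> dual A"
  shows dual_add_eq: "\<lbrakk>X \<in> carrier A; Y \<in> carrier A\<rbrakk> \<Longrightarrow> f (X \<oplus> Y) = f X + f Y"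
    and dual_smult_eq: "X \<in> carrier A \<Longrightarrow> f (c \<odot> X) = c * f X"
    and dual_extensional: "f \<in> extensional (carrier A)"
  using assms by (auto simp: dual_def)

text \<open>The induction truncates the coordinates of \<open>X\<close> to a growing subset of
  \<open>B\<close>, so additivity for two summands suffices and no finite sum inside the carrier is
  formed.\<close>

lemma dual_expand:
  assumes f: "f \<in> dual A" and X: "X \<in> carrier A"
  shows "f X = (\<Sum>p\<in>B. f (basis_elem p) * coord X p)"
proof -
  have "f (elem (\<lambda>q. if q \<in> F then coord X q else 0)) = (\<Sum>p\<in>F. f (basis_elem p) * coord X p)"
    if "F \<subseteq> B" for F
    using finite_subset[OF that finite_basis] that
  proof (induction F rule: finite_induct)
    case empty
    have "elem (\<lambda>q. if q \<in> {} then coord X q else 0) = \<zero>"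
      by (rule coord_eqI) auto
    moreover have "f \<zero> = 0"
      using dual_add_eq[OF f, of \<zero> \<zero>] by (metis add_cancel_right_right l_zero zero_closed)
    ultimately show ?case by simp
  next
    case (insert p F)
    have "elem (\<lambda>q. if q \<in> insert p F then coord X q else 0) =
      elem (\<lambda>q. if q \<in> F then coord X q else 0) \<oplus> coord X p \<odot> basis_elem p"
      by (rule coord_eqI) (use insert.hyps in \<open>auto simp: coord_add coord_smult\<close>)
    with insert show ?case
      by (simp add: dual_add_eq[OF f] dual_smult_eq[OF f])
  qed
  from this[of B] have "f (elem (\<lambda>q. if q \<in> B then coord X q else 0)) = (\<Sum>p\<in>B. f (basis_elem p) * coord X p)"
    by simp
  moreover have "elem (\<lambda>q. if q \<in> B then coord X q else 0) = X"
    by (rule coord_eqI) (use X in auto)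
  ultimately show ?thesis by simp
qed

lemma functional_apply: "X \<in> carrier A \<Longrightarrow> functional h X = (\<Sum>p\<in>B. h p * coord X p)"
  by (simp add: functional_def)

lemma functional_dual [simp, intro]: "functional h \<in> dual A"
  by (auto simp: dual_def functional_def coord_add coord_smult sum_distrib_left
      sum.distrib[symmetric] algebra_simps intro!: sum.cong)

lemma functional_basis_elem [simp]: "p \<in> B \<Longrightarrow> functional h (basis_elem p) = h p"
  by (simp add: functional_def)

lemma functional_of_dual: "f \<in> dual A \<Longrightarrow> functional (\<lambda>p. f (basis_elem p)) = f"
  by (rule extensionalityI[OF _ dual_extensional]) (simp_all add: functional_def dual_expand[symmetric])

lemma dual_add_closed [simp, intro]:
  assumes f: "f \<in> dual A" and g: "g \<in> dual A"
  shows "dual_add A f g \<in> dual A"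
  using f g by (auto simp: dual_def dual_add_def algebra_simps)

lemma dual_act_closed [simp, intro]:
  assumes f: "f \<in> dual A" and "a \<in> carrier A" "b \<in> carrier A"
  shows "dual_act A a f b \<in> dual A"
  using assms by (auto simp: dual_def dual_act_def r_distr l_distr smult_mult_left smult_mult_right)

lemma dual_add_apply: "X \<in> carrier A \<Longrightarrow> dual_add A f g X = f X + g X"
  by (simp add: dual_add_def)

lemma dual_act_apply: "X \<in> carrier A \<Longrightarrow> dual_act A a f b X = f (b \<otimes> X \<otimes> a)"
  by (simp add: dual_act_def)

lemma dual_eqI:
  assumes "f \<in> dual A" "g \<in> dual A" "\<And>X. X \<in> carrier A \<Longrightarrow> f X = g X"
  shows "f = g"
  by (rule extensionalityI[OF dual_extensional[OF assms(1)] dual_extensional[OF assms(2)] assms(3)])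

lemma hom_of_closed [simp, intro]: "f \<in> dual A \<Longrightarrow> hom_of c f \<in> carrier A"
  and coord_hom_of: "\<lbrakk>f \<in> dual A; \<alpha> \<in> B\<rbrakk> \<Longrightarrow>
    coord (hom_of c f) \<alpha> = (\<Sum>\<beta>\<in>B. c \<alpha> \<beta> * f (basis_elem \<beta>))"
  by (auto simp: hom_of_def)

text \<open>Column \<beta> of the matrix holds the coordinates of the image of the functional dual
  to \<beta>. The work lies in recovering linearity from additivity and equivariance.\<close>

lemma bimodule_hom_matrix:
  assumes \<phi>: "\<phi> \<in> bimodule_homs A"
  shows "\<exists>c. \<phi> = hom_of c"
proof -
  define c where "c = (\<lambda>\<alpha> \<beta>. coord (\<phi> (functional (\<lambda>q. of_bool (q = \<beta>)))) \<alpha>)"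
  have closed: "f \<in> dual A \<Longrightarrow> \<phi> f \<in> carrier A" for f
    using \<phi> by (auto simp: bimodule_homs_def)
  have add: "\<lbrakk>f \<in> dual A; g \<in> dual A\<rbrakk> \<Longrightarrow> \<phi> (dual_add A f g) = \<phi> f \<oplus> \<phi> g" for f g
    using \<phi> by (auto simp: bimodule_homs_def)
  have act: "\<lbrakk>f \<in> dual A; a \<in> carrier A; b \<in> carrier A\<rbrakk> \<Longrightarrow>
      \<phi> (dual_act A a f b) = a \<otimes> \<phi> f \<otimes> b" for a b f
    using \<phi> by (auto simp: bimodule_homs_def)
  \<comment> \<open>Scalar multiplication of functionals is the action of
    \<open>k \<odot> \<one>\<close>, so equivariance contains homogeneity.\<close>
  have scale: "\<phi> (dual_act A (k \<odot> \<one>) f \<one>) = k \<odot> \<phi> f" if "f \<in> dual A" for f k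
    using that by (simp add: act closed smult_mult_left)
  have sum: "coord (\<phi> (functional (\<lambda>p. if p \<in> F then h p else 0))) \<alpha> = (\<Sum>\<beta>\<in>F. c \<alpha> \<beta> * h \<beta>)"
    if "F \<subseteq> B" and \<alpha>: "\<alpha> \<in> B" for F h \<alpha>
    using finite_subset[OF that(1) finite_basis] that(1)
  proof (induction F rule: finite_induct)
    case empty
    let ?z = "functional (\<lambda>p. if p \<in> {} then h p else 0)"
    \<comment> \<open>The truncation to the empty set is idempotent under addition, hence so is its
      image, whose coordinates are therefore 0.\<close>
    have "dual_add A ?z ?z = ?z"
      by (auto simp: dual_add_def functional_def)
    then have "\<phi> ?z \<oplus> \<phi> ?z = \<phi> ?z"
      using add[of ?z ?z] by simp
    then show ?case
      using coord_add[of "\<phi> ?z" "\<phi> ?z" \<alpha>] closed[of ?z] \<alpha> by simp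
  next
    case (insert p F)
    let ?f = "functional (\<lambda>p. if p \<in> F then h p else 0)"
    let ?g = "functional (\<lambda>q. of_bool (q = p))"
    have "(if q \<in> insert p F then h q else 0) = (if q \<in> F then h q else 0) + h p * of_bool (q = p)" for q
      using insert.hyps by auto
    then have "functional (\<lambda>q. if q \<in> insert p F then h q else 0) =
        dual_add A ?f (dual_act A (h p \<odot> \<one>) ?g \<one>)"
      using insert.prems
      by (intro dual_eqI) (simp_all add: functional_apply dual_add_apply dual_act_apply
          smult_mult_right coord_smult distrib_right sum.distrib mult.assoc flip: sum_distrib_left)
    then show ?case
      using insert \<alpha> by (simp add: add scale closed coord_add coord_smult c_def ac_simps)
  qed
  have "\<phi> f = hom_of c f" if f: "f \<in> dual A" for f
  proof (rule coord_eqI)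
    fix \<alpha> assume \<alpha>: "\<alpha> \<in> B"
    have "functional (\<lambda>p. if p \<in> B then f (basis_elem p) else 0) = functional (\<lambda>p. f (basis_elem p))"
      by (auto simp: functional_def)
    then show "coord (\<phi> f) \<alpha> = coord (hom_of c f) \<alpha>"
      using sum[of B \<alpha> "\<lambda>p. f (basis_elem p)"] functional_of_dual[OF f] f \<alpha>
      by (simp add: coord_hom_of)
  qed (use f closed in auto)
  moreover have "\<phi> \<in> extensional (dual A)"
    using \<phi> by (simp add: bimodule_homs_def PiE_def)
  moreover have "hom_of c \<in> extensional (dual A)"
    by (simp add: hom_of_def)
  ultimately have "\<phi> = hom_of c"
    by (metis extensionalityI)
  then show ?thesis
    by (rule exI[of _ c])
qed

section \<open>Equivariance in terms of matrix entries\<close>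

lemma swap_sums:
  fixes F :: "'b \<Rightarrow> 'b \<Rightarrow> 'b \<Rightarrow> 'k"
  shows "(\<Sum>x\<in>B. \<Sum>y\<in>B. \<Sum>z\<in>B. F x y z) = (\<Sum>z\<in>B. \<Sum>y\<in>B. \<Sum>x\<in>B. F x y z)"
  by (subst sum.swap, subst (2) sum.swap, subst sum.swap) (rule refl)

lemma dual_mult_basis:
  assumes f: "f \<in> dual A" and a: "a \<in> carrier A" and \<beta>: "\<beta> \<in> B"
  shows "f (basis_elem \<beta> \<otimes> a) = (\<Sum>\<delta>\<in>B. \<Sum>q\<in>B. f (basis_elem \<delta>) * N \<beta> q \<delta> * coord a q)"
    and "f (a \<otimes> basis_elem \<beta>) = (\<Sum>\<delta>\<in>B. \<Sum>q\<in>B. f (basis_elem \<delta>) * N q \<beta> \<delta> * coord a q)"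
proof -
  have "coord (basis_elem \<beta> \<otimes> a) \<delta> = (\<Sum>q\<in>B. N \<beta> q \<delta> * coord a q)" if "\<delta> \<in> B" for \<delta>
  proof -
    have "coord (basis_elem \<beta> \<otimes> a) \<delta> = (\<Sum>q\<in>B. \<Sum>p\<in>B. of_bool (p = \<beta>) * (N p q \<delta> * coord a q))"
      using a that by (subst sum.swap) (simp add: coord_mult ac_simps)
    then show ?thesis
      using \<beta> by simp
  qed
  then show "f (basis_elem \<beta> \<otimes> a) = (\<Sum>\<delta>\<in>B. \<Sum>q\<in>B. f (basis_elem \<delta>) * N \<beta> q \<delta> * coord a q)"
    using a by (simp add: dual_expand[OF f, of "_ \<otimes> _"] sum_distrib_left ac_simps)
  have "coord (a \<otimes> basis_elem \<beta>) \<delta> = (\<Sum>q\<in>B. N q \<beta> \<delta> * coord a q)" if "\<delta> \<in> B" for \<delta>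
  proof -
    have "coord (a \<otimes> basis_elem \<beta>) \<delta> = (\<Sum>q\<in>B. \<Sum>p\<in>B. of_bool (p = \<beta>) * (N q p \<delta> * coord a q))"
      using a that by (simp add: coord_mult ac_simps)
    then show ?thesis
      using \<beta> by simp
  qed
  then show "f (a \<otimes> basis_elem \<beta>) = (\<Sum>\<delta>\<in>B. \<Sum>q\<in>B. f (basis_elem \<delta>) * N q \<beta> \<delta> * coord a q)"
    using a by (simp add: dual_expand[OF f, of "_ \<otimes> _"] sum_distrib_left ac_simps)
qed

text \<open>This and the three following expansions are brought to a common shape with outer weight
  \<open>coord a q * f (basis_elem \<delta>)\<close>. Equivariance then reduces to equality of the
  inner sums, which for the left action are the two sides of \<open>balanced\<close>.\<close>

lemma coord_hom_of_left_act:
  assumes f: "f \<in> dual A" and a: "a \<in> carrier A" and \<alpha>: "\<alpha> \<in> B"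
  shows "coord (hom_of c (dual_act A a f \<one>)) \<alpha> =
    (\<Sum>q\<in>B. \<Sum>\<delta>\<in>B. coord a q * f (basis_elem \<delta>) * (\<Sum>\<beta>\<in>B. N \<beta> q \<delta> * c \<alpha> \<beta>))"
proof -
  have "coord (hom_of c (dual_act A a f \<one>)) \<alpha> = (\<Sum>\<beta>\<in>B. c \<alpha> \<beta> * f (basis_elem \<beta> \<otimes> a))"
    using f a \<alpha> by (simp add: coord_hom_of dual_act_apply)
  also have "\<dots> = (\<Sum>\<beta>\<in>B. \<Sum>\<delta>\<in>B. \<Sum>q\<in>B. coord a q * f (basis_elem \<delta>) * (N \<beta> q \<delta> * c \<alpha> \<beta>))"
    using f a by (simp add: dual_mult_basis sum_distrib_left ac_simps)
  finally show ?thesis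
    by (subst (asm) swap_sums) (simp add: sum_distrib_left)
qed

lemma coord_hom_of_right_act:
  assumes f: "f \<in> dual A" and a: "a \<in> carrier A" and \<alpha>: "\<alpha> \<in> B"
  shows "coord (hom_of c (dual_act A \<one> f a)) \<alpha> =
    (\<Sum>q\<in>B. \<Sum>\<delta>\<in>B. coord a q * f (basis_elem \<delta>) * (\<Sum>\<beta>\<in>B. N q \<beta> \<delta> * c \<alpha> \<beta>))"
proof -
  have "coord (hom_of c (dual_act A \<one> f a)) \<alpha> = (\<Sum>\<beta>\<in>B. c \<alpha> \<beta> * f (a \<otimes> basis_elem \<beta>))"
    using f a \<alpha> by (simp add: coord_hom_of dual_act_apply)
  also have "\<dots> = (\<Sum>\<beta>\<in>B. \<Sum>\<delta>\<in>B. \<Sum>q\<in>B. coord a q * f (basis_elem \<delta>) * (N q \<beta> \<delta> * c \<alpha> \<beta>))"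
    using f a by (simp add: dual_mult_basis sum_distrib_left ac_simps)
  finally show ?thesis
    by (subst (asm) swap_sums) (simp add: sum_distrib_left)
qed

lemma coord_mult_hom_of_left:
  assumes f: "f \<in> dual A" and a: "a \<in> carrier A" and \<alpha>: "\<alpha> \<in> B"
  shows "coord (a \<otimes> hom_of c f) \<alpha> =
    (\<Sum>q\<in>B. \<Sum>\<delta>\<in>B. coord a q * f (basis_elem \<delta>) * (\<Sum>\<gamma>\<in>B. N q \<gamma> \<alpha> * c \<gamma> \<delta>))"
proof -
  have "coord (a \<otimes> hom_of c f) \<alpha> =
      (\<Sum>q\<in>B. \<Sum>\<gamma>\<in>B. \<Sum>\<delta>\<in>B. coord a q * f (basis_elem \<delta>) * (N q \<gamma> \<alpha> * c \<gamma> \<delta>))"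
    using f a \<alpha> by (simp add: coord_mult coord_hom_of sum_distrib_left ac_simps)
  also have "\<dots> = (\<Sum>q\<in>B. \<Sum>\<delta>\<in>B. \<Sum>\<gamma>\<in>B. coord a q * f (basis_elem \<delta>) * (N q \<gamma> \<alpha> * c \<gamma> \<delta>))"
    by (rule sum.cong[OF refl], rule sum.swap)
  finally show ?thesis
    by (simp add: sum_distrib_left)
qed

text \<open>Compared with \<open>coord_hom_of_right_act\<close>, the inner sums are the two sides of
  \<open>balanced\<close> for the transposed matrix, with \<alpha> and \<delta> exchanged.\<close>

lemma coord_mult_hom_of_right:
  assumes f: "f \<in> dual A" and a: "a \<in> carrier A" and \<alpha>: "\<alpha> \<in> B"
  shows "coord (hom_of c f \<otimes> a) \<alpha> =
    (\<Sum>q\<in>B. \<Sum>\<delta>\<in>B. coord a q * f (basis_elem \<delta>) * (\<Sum>\<gamma>\<in>B. N \<gamma> q \<alpha> * c \<gamma> \<delta>))"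
proof -
  have "coord (hom_of c f \<otimes> a) \<alpha> =
      (\<Sum>\<gamma>\<in>B. \<Sum>q\<in>B. \<Sum>\<delta>\<in>B. coord a q * f (basis_elem \<delta>) * (N \<gamma> q \<alpha> * c \<gamma> \<delta>))"
    using f a \<alpha> by (simp add: coord_mult coord_hom_of sum_distrib_left ac_simps)
  also have "\<dots> = (\<Sum>q\<in>B. \<Sum>\<gamma>\<in>B. \<Sum>\<delta>\<in>B. coord a q * f (basis_elem \<delta>) * (N \<gamma> q \<alpha> * c \<gamma> \<delta>))"
    by (rule sum.swap)
  also have "\<dots> = (\<Sum>q\<in>B. \<Sum>\<delta>\<in>B. \<Sum>\<gamma>\<in>B. coord a q * f (basis_elem \<delta>) * (N \<gamma> q \<alpha> * c \<gamma> \<delta>))"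
    by (rule sum.cong[OF refl], rule sum.swap)
  finally show ?thesis
    by (simp add: sum_distrib_left)
qed

text \<open>Testing equivariance on the basis element \<open>q\<close> and the functional dual to
  \<delta> collapses both outer sums to a single term.\<close>

lemma balanced_if_hom:
  assumes hom: "hom_of c \<in> bimodule_homs A" and q: "q \<in> B"
  shows "balanced c q"
  unfolding balanced_def
proof (intro ballI)
  fix \<alpha> \<delta> assume \<alpha>: "\<alpha> \<in> B" and \<delta>: "\<delta> \<in> B"
  define f where "f = functional (\<lambda>p. of_bool (p = \<delta>))"
  have f: "f \<in> dual A" and f_basis: "p \<in> B \<Longrightarrow> f (basis_elem p) = of_bool (p = \<delta>)" for p
    by (auto simp: f_def)
  have "hom_of c (dual_act A (basis_elem q) f \<one>) = basis_elem q \<otimes> hom_of c f \<otimes> \<one>"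
    using hom f by (auto simp: bimodule_homs_def)
  then have "coord (hom_of c (dual_act A (basis_elem q) f \<one>)) \<alpha> = coord (basis_elem q \<otimes> hom_of c f) \<alpha>"
    using f by simp
  then show "(\<Sum>\<beta>\<in>B. N \<beta> q \<delta> * c \<alpha> \<beta>) = (\<Sum>\<gamma>\<in>B. N q \<gamma> \<alpha> * c \<gamma> \<delta>)"
    using f f_basis q \<alpha> \<delta>
    by (simp add: coord_hom_of_left_act coord_mult_hom_of_left mult.assoc flip: sum_distrib_left)
qed

text \<open>Equivariance on the right is equivariance on the left of the transposed matrix.\<close>

lemma hom_of_bimodule_hom:
  assumes left: "\<And>q. q \<in> B \<Longrightarrow> balanced c q" and right: "\<And>q. q \<in> B \<Longrightarrow> balanced (\<lambda>\<alpha> \<beta>. c \<beta> \<alpha>) q"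
  shows "hom_of c \<in> bimodule_homs A"
proof -
  have left_act: "hom_of c (dual_act A a f \<one>) = a \<otimes> hom_of c f"
    if f: "f \<in> dual A" and a: "a \<in> carrier A" for a f
    by (rule coord_eqI)
      (use left f a in \<open>auto simp: coord_hom_of_left_act coord_mult_hom_of_left balanced_def\<close>)
  have right_act: "hom_of c (dual_act A \<one> f a) = hom_of c f \<otimes> a"
    if f: "f \<in> dual A" and a: "a \<in> carrier A" for a f
    by (rule coord_eqI)
      (use right f a in \<open>auto simp: coord_hom_of_right_act coord_mult_hom_of_right balanced_def\<close>)
  have act_split: "dual_act A a f b = dual_act A a (dual_act A \<one> f b) \<one>"
    if "f \<in> dual A" "a \<in> carrier A" "b \<in> carrier A" for a b f
    using that by (auto simp: dual_act_def m_assoc)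
  have "hom_of c (dual_act A a f b) = a \<otimes> hom_of c f \<otimes> b"
    if "f \<in> dual A" "a \<in> carrier A" "b \<in> carrier A" for a b f
    by (subst act_split) (use that in \<open>simp_all add: left_act right_act m_assoc\<close>)
  moreover have "hom_of c (dual_add A f g) = hom_of c f \<oplus> hom_of c g"
    if "f \<in> dual A" "g \<in> dual A" for f g
    by (rule coord_eqI)
      (use that in \<open>auto simp: coord_hom_of coord_add dual_add_apply distrib_left sum.distrib\<close>)
  moreover have "hom_of c \<in> dual A \<rightarrow>\<^sub>E carrier A"
    by (auto simp: hom_of_def)
  ultimately show ?thesis
    by (auto simp: bimodule_homs_def)
qed

section \<open>Transposition and alternating morphisms\<close>

text \<open>Coordinate functionals separate the elements of \<open>A\<close>. With an explicit
  preimage at hand, this evaluates the \<open>inv_into\<close> in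
  \<open>bimodule_transpose\<close>.\<close>

lemma bidual_map_inj: "inj_on (bidual_map A) (carrier A)"
proof (rule inj_onI)
  fix X Y assume X: "X \<in> carrier A" and Y: "Y \<in> carrier A" and eq: "bidual_map A X = bidual_map A Y"
  have f_eq: "f X = f Y" if "f \<in> dual A" for f
    using fun_cong[OF eq, of f] that by (simp add: bidual_map_def)
  have "functional (\<lambda>q. of_bool (q = p)) X = functional (\<lambda>q. of_bool (q = p)) Y" for p
    by (rule f_eq) simp
  then have sum_eq: "(\<Sum>q\<in>B. of_bool (q = p) * coord X q) = (\<Sum>q\<in>B. of_bool (q = p) * coord Y q)" for p
    using X Y by (simp only: functional_apply)
  have "coord X p = coord Y p" if "p \<in> B" for p
    using sum_eq[of p] that by simp
  then show "X = Y"
    by (rule coord_eqI[OF X Y])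
qed

text \<open>Both \<open>f (hom_of c g)\<close> and \<open>g\<close> applied to the transposed map at
  \<open>f\<close> are the bilinear form with matrix \<open>c\<close> evaluated at \<open>f\<close>
  and \<open>g\<close>. So the functional to be inverted is evaluation at an explicit
  element.\<close>

lemma transpose_hom_of: "bimodule_transpose A (hom_of c) = hom_of (\<lambda>\<alpha> \<beta>. c \<beta> \<alpha>)"
proof -
  have "bimodule_transpose A (hom_of c) f = hom_of (\<lambda>\<alpha> \<beta>. c \<beta> \<alpha>) f" if f: "f \<in> dual A" for f
  proof -
    have "f (hom_of c g) = g (hom_of (\<lambda>\<alpha> \<beta>. c \<beta> \<alpha>) f)" if g: "g \<in> dual A" for g
    proof -
      have "f (hom_of c g) = (\<Sum>p\<in>B. \<Sum>q\<in>B. f (basis_elem p) * c p q * g (basis_elem q))"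
        using f g by (simp add: dual_expand[OF f, of "hom_of _ _"] coord_hom_of sum_distrib_left ac_simps)
      also have "\<dots> = (\<Sum>q\<in>B. \<Sum>p\<in>B. f (basis_elem p) * c p q * g (basis_elem q))"
        by (rule sum.swap)
      also have "\<dots> = g (hom_of (\<lambda>\<alpha> \<beta>. c \<beta> \<alpha>) f)"
        using f g by (simp add: dual_expand[OF g, of "hom_of _ _"] coord_hom_of sum_distrib_left ac_simps)
      finally show ?thesis .
    qed
    then have "(\<lambda>g\<in>dual A. f (hom_of c g)) = bidual_map A (hom_of (\<lambda>\<alpha> \<beta>. c \<beta> \<alpha>) f)"
      unfolding bidual_map_def by (rule restrict_ext)
    then show ?thesis
      using f by (simp add: bimodule_transpose_def inv_into_f_f[OF bidual_map_inj])
  qed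
  moreover have "bimodule_transpose A (hom_of c) f = hom_of (\<lambda>\<alpha> \<beta>. c \<beta> \<alpha>) f" if "f \<notin> dual A" for f
    using that by (simp add: bimodule_transpose_def hom_of_def)
  ultimately show ?thesis
    by blast
qed

lemma hom_of_eq_zero_hom_iff: "hom_of c = zero_hom A \<longleftrightarrow> (\<forall>f\<in>dual A. hom_of c f = \<zero>)"
proof
  assume "\<forall>f\<in>dual A. hom_of c f = \<zero>"
  then have "hom_of c f = zero_hom A f" for f
    by (cases "f \<in> dual A") (simp_all add: zero_hom_def, simp add: hom_of_def)
  then show "hom_of c = zero_hom A" ..
qed (simp add: zero_hom_def)

lemma hom_of_eq_zero_iff: "hom_of c = zero_hom A \<longleftrightarrow> (\<forall>\<alpha>\<in>B. \<forall>\<beta>\<in>B. c \<alpha> \<beta> = 0)"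
proof
  assume eq: "hom_of c = zero_hom A"
  show "\<forall>\<alpha>\<in>B. \<forall>\<beta>\<in>B. c \<alpha> \<beta> = 0"
  proof (intro ballI)
    fix \<alpha> \<beta> assume "\<alpha> \<in> B" "\<beta> \<in> B"
    then show "c \<alpha> \<beta> = 0"
      using arg_cong[OF fun_cong[OF eq, of "functional (\<lambda>p. of_bool (p = \<beta>))"], of "\<lambda>X. coord X \<alpha>"]
      by (simp add: coord_hom_of zero_hom_def)
  qed
next
  assume "\<forall>\<alpha>\<in>B. \<forall>\<beta>\<in>B. c \<alpha> \<beta> = 0"
  then have "hom_of c f = \<zero>" if "f \<in> dual A" for f
    by (intro coord_eqI) (use that in \<open>auto simp: coord_hom_of\<close>)
  then show "hom_of c = zero_hom A"
    by (simp add: hom_of_eq_zero_hom_iff)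
qed

lemma hom_of_Alt_iff:
  "hom_of c \<in> Alt A \<longleftrightarrow> (\<forall>q\<in>B. balanced c q) \<and> (\<forall>\<alpha>\<in>B. \<forall>\<beta>\<in>B. c \<alpha> \<beta> + c \<beta> \<alpha> = 0)"
proof -
  \<comment> \<open>Additivity of \<open>hom_of\<close> in the matrix turns the alternating
    condition into the vanishing of \<open>c\<close> plus its transpose, entry by entry.\<close>
  have "hom_of c f \<oplus> hom_of (\<lambda>\<alpha> \<beta>. c \<beta> \<alpha>) f = hom_of (\<lambda>\<alpha> \<beta>. c \<alpha> \<beta> + c \<beta> \<alpha>) f" if "f \<in> dual A" for f
    by (rule coord_eqI) (use that in \<open>auto simp: coord_hom_of coord_add distrib_right sum.distrib\<close>)
  then have "(\<forall>f\<in>dual A. hom_of c f \<oplus> bimodule_transpose A (hom_of c) f = \<zero>) \<longleftrightarrow>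
      hom_of (\<lambda>\<alpha> \<beta>. c \<alpha> \<beta> + c \<beta> \<alpha>) = zero_hom A"
    by (simp add: transpose_hom_of hom_of_eq_zero_hom_iff)
  then have Alt: "hom_of c \<in> Alt A \<longleftrightarrow>
      hom_of c \<in> bimodule_homs A \<and> (\<forall>\<alpha>\<in>B. \<forall>\<beta>\<in>B. c \<alpha> \<beta> + c \<beta> \<alpha> = 0)"
    by (simp add: Alt_def hom_of_eq_zero_iff)
  have "hom_of c \<in> bimodule_homs A"
    if bal: "\<forall>q\<in>B. balanced c q" and alt: "\<forall>\<alpha>\<in>B. \<forall>\<beta>\<in>B. c \<alpha> \<beta> + c \<beta> \<alpha> = 0"
  proof (rule hom_of_bimodule_hom)
    fix q assume q: "q \<in> B"
    have neg: "c \<beta> \<alpha> = - c \<alpha> \<beta>" if "\<alpha> \<in> B" "\<beta> \<in> B" for \<alpha> \<beta>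
      using alt that by (simp add: eq_neg_iff_add_eq_0)
    show "balanced (\<lambda>\<alpha> \<beta>. c \<beta> \<alpha>) q"
      unfolding balanced_def
    proof (intro ballI)
      fix \<alpha> \<delta> assume \<alpha>: "\<alpha> \<in> B" and \<delta>: "\<delta> \<in> B"
      have "(\<Sum>\<beta>\<in>B. N \<beta> q \<delta> * c \<beta> \<alpha>) = (\<Sum>\<beta>\<in>B. N \<beta> q \<delta> * - c \<alpha> \<beta>)"
        by (intro sum.cong refl arg_cong2[where f = "(*)"] neg \<alpha>)
      also have "\<dots> = (\<Sum>\<gamma>\<in>B. N q \<gamma> \<alpha> * - c \<gamma> \<delta>)"
        using bal q \<alpha> \<delta> by (simp add: balanced_def sum_negf)
      also have "\<dots> = (\<Sum>\<gamma>\<in>B. N q \<gamma> \<alpha> * c \<delta> \<gamma>)"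
        by (intro sum.cong refl arg_cong2[where f = "(*)"] neg[symmetric] \<delta>)
      finally show "(\<Sum>\<beta>\<in>B. N \<beta> q \<delta> * c \<beta> \<alpha>) = (\<Sum>\<gamma>\<in>B. N q \<gamma> \<alpha> * c \<delta> \<gamma>)" .
    qed
  qed (use bal in blast)
  with Alt show ?thesis
    using balanced_if_hom by blast
qed

text \<open>The algebra disappears from the problem here. A matrix is a total function
  \<open>c\<close>, hence vanishing is asserted on \<open>B\<close> only; \<open>zero_hom\<close>
  always belongs to \<open>Alt A\<close>, so triviality is one inclusion.\<close>

lemma Alt_trivial_iff:
  "Alt A = {zero_hom A} \<longleftrightarrow>
    (\<forall>c. (\<forall>q\<in>B. balanced c q) \<and> (\<forall>\<alpha>\<in>B. \<forall>\<beta>\<in>B. c \<alpha> \<beta> + c \<beta> \<alpha> = 0) \<longrightarrow>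
      (\<forall>\<alpha>\<in>B. \<forall>\<beta>\<in>B. c \<alpha> \<beta> = 0))"
proof -
  have zero: "hom_of (\<lambda>_ _. 0) = zero_hom A"
    by (subst hom_of_eq_zero_iff) simp
  have "hom_of (\<lambda>_ _. 0) \<in> Alt A"
    by (subst hom_of_Alt_iff) (simp add: balanced_def)
  then have "zero_hom A \<in> Alt A"
    by (simp only: zero)
  then have Alt: "Alt A = {zero_hom A} \<longleftrightarrow> Alt A \<subseteq> {zero_hom A}"
    by blast
  have "Alt A \<subseteq> {zero_hom A} \<longleftrightarrow> (\<forall>c. hom_of c \<in> Alt A \<longrightarrow> hom_of c = zero_hom A)"
  proof
    assume *: "\<forall>c. hom_of c \<in> Alt A \<longrightarrow> hom_of c = zero_hom A"
    show "Alt A \<subseteq> {zero_hom A}"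
    proof
      fix \<phi> assume \<phi>: "\<phi> \<in> Alt A"
      then have "\<phi> \<in> bimodule_homs A"
        by (simp add: Alt_def)
      then obtain c where "\<phi> = hom_of c"
        by (auto dest: bimodule_hom_matrix)
      then show "\<phi> \<in> {zero_hom A}"
        using \<phi> *[rule_format, of c] by simp
    qed
  qed (simp add: subset_iff)
  then show ?thesis
    by (simp only: Alt hom_of_Alt_iff hom_of_eq_zero_iff)
qed

end

section \<open>Paths\<close>

lemma psrc_pconc [simp]: "psrc (p \<cdot> q) = psrc q"
  and ptgt_pconc [simp]: "ptgt (p \<cdot> q) = ptgt p"
  and parrows_pconc [simp]: "parrows (p \<cdot> q) = parrows q @ parrows p"
  by (simp_all add: pconc_def)

lemma pconc_assoc: "p \<cdot> q \<cdot> r = p \<cdot> (q \<cdot> r)"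
  by (simp add: pconc_def)

lemma composable_pconc_left [simp]: "composable (p \<cdot> q) r \<longleftrightarrow> composable q r"
  and composable_pconc_right [simp]: "composable p (q \<cdot> r) \<longleftrightarrow> composable p q"
  by (simp_all add: composable_def)

lemma path_eqI: "\<lbrakk>psrc p = psrc q; parrows p = parrows q; ptgt p = ptgt q\<rbrakk> \<Longrightarrow> p = q"
  by (cases p; cases q) simp

text \<open>Concatenation forgets the vertex where the two paths meet; composability restores it as
  the source of \<open>p\<close>.\<close>

lemma pconc_cancel_left: "\<lbrakk>composable p q; composable p q'; p \<cdot> q = p \<cdot> q'\<rbrakk> \<Longrightarrow> q = q'"
  by (rule path_eqI) (auto simp: pconc_def composable_def)

lemma pconc_cancel_right: "\<lbrakk>composable p q; composable p' q; p \<cdot> q = p' \<cdot> q\<rbrakk> \<Longrightarrow> p = p'"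
  by (rule path_eqI) (auto simp: pconc_def composable_def)

lemma (in pre_digraph) cas_append: "cas u (es @ es') v \<longleftrightarrow> (\<exists>m. cas u es m \<and> cas m es' v)"
  by (induction es arbitrary: u) auto

lemma qpaths_iff:
  "p \<in> qpaths Q \<longleftrightarrow> psrc p \<in> verts Q \<and> set (parrows p) \<subseteq> arcs Q \<and>
    pre_digraph.cas Q (psrc p) (parrows p) (ptgt p)"
  by (cases p) (simp add: qpaths_def pre_digraph.awalk_def)

lemma arrow_simps [simp]:
  "psrc (arrow Q a) = tail Q a" "parrows (arrow Q a) = [a]" "ptgt (arrow Q a) = head Q a"
  by (simp_all add: arrow_def)

context wf_digraph
begin

lemma ptgt_in_verts: "p \<in> qpaths G \<Longrightarrow> ptgt p \<in> verts G"
  by (cases p) (auto simp: qpaths_def)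

lemma pconc_in_qpaths: "\<lbrakk>p \<in> qpaths G; q \<in> qpaths G; composable p q\<rbrakk> \<Longrightarrow> p \<cdot> q \<in> qpaths G"
  by (cases p; cases q) (auto simp: qpaths_def composable_def pconc_def intro: awalk_appendI)

lemma arrow_in_qpaths: "a \<in> arcs G \<Longrightarrow> arrow G a \<in> qpaths G"
  by (simp add: qpaths_iff pre_digraph.cas.simps)

lemma vertex_in_qpaths: "v \<in> verts G \<Longrightarrow> (v, [], v) \<in> qpaths G"
  by (simp add: qpaths_iff pre_digraph.cas.simps)

text \<open>An occurrence of \<open>z\<close> in one factor survives in the product: the other
  factor is absorbed into the flank next to it.\<close>

lemma subpath_pconc:
  assumes "p \<in> qpaths G" "q \<in> qpaths G" "composable p q" and sub: "subpath G z p \<or> subpath G z q"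
  shows "subpath G z (p \<cdot> q)"
  using sub
proof
  assume "subpath G z p"
  then obtain x y where xy: "x \<in> qpaths G" "y \<in> qpaths G" "composable x z" "composable z y" "p = x \<cdot> z \<cdot> y"
    by (auto simp only: subpath_def)
  then have "y \<cdot> q \<in> qpaths G" "composable z (y \<cdot> q)" "p \<cdot> q = x \<cdot> z \<cdot> (y \<cdot> q)"
    using assms by (simp_all add: pconc_in_qpaths pconc_assoc)
  with xy show ?thesis
    unfolding subpath_def by blast
next
  assume "subpath G z q"
  then obtain x y where xy: "x \<in> qpaths G" "y \<in> qpaths G" "composable x z" "composable z y" "q = x \<cdot> z \<cdot> y"
    by (auto simp only: subpath_def)
  then have "p \<cdot> x \<in> qpaths G" "composable (p \<cdot> x) z" "p \<cdot> q = p \<cdot> x \<cdot> z \<cdot> y"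
    using assms by (simp_all add: pconc_in_qpaths pconc_assoc)
  with xy show ?thesis
    unfolding subpath_def by blast
qed

text \<open>Arrows are listed in the order of traversal while products are written right to left. So
  the last list entry splits off as a left factor and, in \<open>Cons_path\<close>, the first entry
  as a right factor.\<close>

lemma snoc_path:
  assumes p: "p \<in> qpaths G" and w: "parrows p = es @ [a]"
  obtains q where "q \<in> qpaths G" "a \<in> arcs G" "composable (arrow G a) q" "p = arrow G a \<cdot> q"
    "parrows q = es"
proof
  let ?q = "(psrc p, es, tail G a)"
  have cas: "cas (psrc p) es (tail G a)" "head G a = ptgt p" and a: "a \<in> arcs G" "set es \<subseteq> arcs G"
    using p w by (auto simp: qpaths_iff cas_append)
  then show "?q \<in> qpaths G"
    using p by (simp add: qpaths_iff)
  show "composable (arrow G a) ?q" "p = arrow G a \<cdot> ?q"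
    using cas w by (auto simp: composable_def intro: path_eqI)
qed (use p w in \<open>auto simp: qpaths_iff\<close>)

lemma Cons_path:
  assumes p: "p \<in> qpaths G" and w: "parrows p = a # es"
  obtains q where "q \<in> qpaths G" "a \<in> arcs G" "composable q (arrow G a)" "p = q \<cdot> arrow G a"
    "parrows q = es"
proof
  let ?q = "(head G a, es, ptgt p)"
  have cas: "cas (head G a) es (ptgt p)" "tail G a = psrc p" and a: "a \<in> arcs G" "set es \<subseteq> arcs G"
    using p w by (auto simp: qpaths_iff)
  then show "?q \<in> qpaths G"
    by (simp add: qpaths_iff)
  show "composable ?q (arrow G a)" "p = ?q \<cdot> arrow G a"
    using cas w by (auto simp: composable_def intro: path_eqI)
qed (use p w in \<open>auto simp: qpaths_iff\<close>)

end

section \<open>The path algebra\<close>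

context fin_digraph
begin

text \<open>Index set of the convolution product. Its finiteness matters because \<open>sum\<close>
  over an infinite set is 0 by convention.\<close>

definition splits :: "('a, 'b) qpath \<Rightarrow> (('a, 'b) qpath \<times> ('a, 'b) qpath) set" where
  "splits r = {(p, q). p \<in> qpaths G \<and> q \<in> qpaths G \<and> composable p q \<and> p \<cdot> q = r}"

lemma splitsI: "\<lbrakk>p \<in> qpaths G; q \<in> qpaths G; composable p q; p \<cdot> q = r\<rbrakk> \<Longrightarrow> (p, q) \<in> splits r"
  by (simp add: splits_def)

lemma splitsE:
  assumes "(p, q) \<in> splits r"
  obtains "p \<in> qpaths G" "q \<in> qpaths G" "composable p q" "p \<cdot> q = r"
  using assms by (simp add: splits_def)

text \<open>The two ways of rebracketing a factorization into three paths. Projections replace pairs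
  to match the goals left by the reindexing in \<open>path_algebra_assoc\<close>.\<close>

lemma splits_assoc:
  "\<lbrakk>x \<in> splits r; y \<in> splits (fst x)\<rbrakk> \<Longrightarrow>
    (fst y, snd y \<cdot> snd x) \<in> splits r \<and> (snd y, snd x) \<in> splits (snd y \<cdot> snd x) \<and> fst y \<cdot> snd y = fst x"
  "\<lbrakk>x \<in> splits r; y \<in> splits (snd x)\<rbrakk> \<Longrightarrow>
    (fst x \<cdot> fst y, snd y) \<in> splits r \<and> (fst x, fst y) \<in> splits (fst x \<cdot> fst y) \<and> fst y \<cdot> snd y = snd x"
proof -
  have "\<lbrakk>(s, c) \<in> splits r; (a, b) \<in> splits s\<rbrakk> \<Longrightarrow>
      (a, b \<cdot> c) \<in> splits r \<and> (b, c) \<in> splits (b \<cdot> c) \<and> a \<cdot> b = s"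
    and "\<lbrakk>(c, s) \<in> splits r; (a, b) \<in> splits s\<rbrakk> \<Longrightarrow>
      (c \<cdot> a, b) \<in> splits r \<and> (c, a) \<in> splits (c \<cdot> a) \<and> a \<cdot> b = s" for a b c s
    by (auto simp: splits_def pconc_assoc pconc_in_qpaths)
  note * = this[of "fst x" "snd x" "fst y" "snd y"] this[of "snd x" "fst x" "fst y" "snd y"]
  show "\<lbrakk>x \<in> splits r; y \<in> splits (fst x)\<rbrakk> \<Longrightarrow>
      (fst y, snd y \<cdot> snd x) \<in> splits r \<and> (snd y, snd x) \<in> splits (snd y \<cdot> snd x) \<and> fst y \<cdot> snd y = fst x"
    "\<lbrakk>x \<in> splits r; y \<in> splits (snd x)\<rbrakk> \<Longrightarrow>
      (fst x \<cdot> fst y, snd y) \<in> splits r \<and> (fst x, fst y) \<in> splits (fst x \<cdot> fst y) \<and> fst y \<cdot> snd y = snd x"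
    using * by auto
qed

lemma mem_Sigma_proj: "x \<in> Sigma S f \<longleftrightarrow> fst x \<in> S \<and> snd x \<in> f (fst x)"
  by (cases x) simp

lemma eq_pair_proj: "((u, v), w) = x \<longleftrightarrow> u = fst (fst x) \<and> v = snd (fst x) \<and> w = snd x"
  by (cases x) auto

lemma finite_splits [simp]: "finite (splits r)"
proof (rule finite_subset)
  \<comment> \<open>A factorization is determined by the number \<open>i\<close> of arrows in its
    right factor and by the meeting vertex \<open>m\<close>.\<close>
  let ?f = "\<lambda>(i, m). ((m, drop i (parrows r), ptgt r), (psrc r, take i (parrows r), m))"
  show "splits r \<subseteq> ?f ` ({..length (parrows r)} \<times> verts G)"
  proof (clarsimp simp only: split_paired_all)
    fix u w v u' w' v'
    assume "((u, w, v), (u', w', v')) \<in> splits r"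
    then have "((u, w, v), (u', w', v')) = ?f (length w', u)" "length w' \<le> length (parrows r)" "u \<in> verts G"
      by (auto simp: splits_def qpaths_iff composable_def pconc_def)
    then show "((u, w, v), (u', w', v')) \<in> ?f ` ({..length (parrows r)} \<times> verts G)"
      by (intro image_eqI[of _ _ "(length w', u)"]) auto
  qed
qed simp

lemma path_algebra_simps:
  "carrier (path_algebra G) = {x. finite {p. x p \<noteq> 0} \<and> {p. x p \<noteq> 0} \<subseteq> qpaths G}"
  "x \<otimes>\<^bsub>path_algebra G\<^esub> y = (\<lambda>r. \<Sum>(p, q)\<in>splits r. x p * y q)"
  "\<one>\<^bsub>path_algebra G\<^esub> = (\<lambda>p. if p \<in> qpaths G \<and> parrows p = [] then 1 else 0)"
  "\<zero>\<^bsub>path_algebra G\<^esub> = (\<lambda>p. 0)"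
  "x \<oplus>\<^bsub>path_algebra G\<^esub> y = (\<lambda>p. x p + y p)"
  "c \<odot>\<^bsub>path_algebra G\<^esub> x = (\<lambda>p. c * x p)"
  by (simp_all add: path_algebra_def splits_def)

lemma path_algebra_apply:
  "(x \<oplus>\<^bsub>path_algebra G\<^esub> y) p = x p + y p"
  "\<zero>\<^bsub>path_algebra G\<^esub> p = 0"
  "(c \<odot>\<^bsub>path_algebra G\<^esub> x) p = c * x p"
  by (simp_all add: path_algebra_simps)

text \<open>A nonzero coefficient of the product needs a nonzero summand, so the support lies in the
  image of the product of two finite supports.\<close>

lemma path_algebra_mult_closed:
  assumes x: "x \<in> carrier (path_algebra G)" and y: "y \<in> carrier (path_algebra G)"
  shows "x \<otimes>\<^bsub>path_algebra G\<^esub> y \<in> carrier (path_algebra G)"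
proof -
  let ?S = "{r. (\<Sum>(p, q)\<in>splits r. x p * y q) \<noteq> 0}"
  have "\<exists>p q. (p, q) \<in> splits r \<and> x p \<noteq> 0 \<and> y q \<noteq> 0" if "r \<in> ?S" for r
  proof -
    obtain a where "a \<in> splits r" "(case a of (p, q) \<Rightarrow> x p * y q) \<noteq> 0"
      using sum.not_neutral_contains_not_neutral[of "\<lambda>(p, q). x p * y q" "splits r"] \<open>r \<in> ?S\<close> by blast
    then have "(fst a, snd a) \<in> splits r \<and> x (fst a) \<noteq> 0 \<and> y (snd a) \<noteq> 0"
      by (simp add: split_def)
    then show ?thesis by blast
  qed
  then have S: "\<exists>p q. p \<cdot> q = r \<and> p \<cdot> q \<in> qpaths G \<and> x p \<noteq> 0 \<and> y q \<noteq> 0" if "r \<in> ?S" for r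
    using that by (meson pconc_in_qpaths splitsE)
  have "?S \<subseteq> (\<lambda>(p, q). p \<cdot> q) ` ({p. x p \<noteq> 0} \<times> {q. y q \<noteq> 0})"
  proof
    fix r assume "r \<in> ?S"
    then obtain p q where "p \<cdot> q = r" "x p \<noteq> 0" "y q \<noteq> 0" using S by blast
    then show "r \<in> (\<lambda>(p, q). p \<cdot> q) ` ({p. x p \<noteq> 0} \<times> {q. y q \<noteq> 0})"
      by (intro image_eqI[of _ _ "(p, q)"]) auto
  qed
  moreover have "?S \<subseteq> qpaths G"
    using S by blast
  moreover have "finite ({p. x p \<noteq> 0} \<times> {q. y q \<noteq> 0})"
    using x y by (simp add: path_algebra_simps)
  ultimately show ?thesis
    by (auto simp: path_algebra_simps intro: finite_subset)
qed

lemma path_algebra_assoc: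
  fixes x y z :: "('a, 'b) qpath \<Rightarrow> 'k::field"
  shows "x \<otimes>\<^bsub>path_algebra G\<^esub> y \<otimes>\<^bsub>path_algebra G\<^esub> z = x \<otimes>\<^bsub>path_algebra G\<^esub> (y \<otimes>\<^bsub>path_algebra G\<^esub> z)"
proof
  fix r
  let ?L = "Sigma (splits r) (\<lambda>(s, c). splits s)" and ?R = "Sigma (splits r) (\<lambda>(a, t). splits t)"
  have "(\<Sum>(s, c)\<in>splits r. (\<Sum>(a, b)\<in>splits s. x a * y b) * z c) =
      (\<Sum>((s, c), (a, b))\<in>?L. x a * y b * z c)"
    by (subst sum.Sigma[symmetric]) (auto simp: sum_distrib_right split_def)
  \<comment> \<open>Both iterated sums run over the factorizations of \<open>r\<close> into three
    paths; the bijection moves the bracket.\<close>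
  also have "\<dots> = (\<Sum>((a, t), (b, c))\<in>?R. x a * y b * z c)"
    by (rule sum.reindex_bij_witness[where
          i = "\<lambda>((a, t), (b, c)). ((a \<cdot> b, c), (a, b))" and j = "\<lambda>((s, c), (a, b)). ((a, b \<cdot> c), (b, c))"])
      (simp_all add: mem_Sigma_proj split_beta eq_pair_proj, (blast dest: splits_assoc)+)
  also have "\<dots> = (\<Sum>(a, t)\<in>splits r. x a * (\<Sum>(b, c)\<in>splits t. y b * z c))"
    by (subst sum.Sigma[symmetric]) (auto simp: sum_distrib_left split_def mult.assoc)
  finally show "(x \<otimes>\<^bsub>path_algebra G\<^esub> y \<otimes>\<^bsub>path_algebra G\<^esub> z) r = (x \<otimes>\<^bsub>path_algebra G\<^esub> (y \<otimes>\<^bsub>path_algebra G\<^esub> z)) r"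
    by (simp add: path_algebra_simps)
qed

lemma path_algebra_one_mult:
  fixes x :: "('a, 'b) qpath \<Rightarrow> 'k::field"
  assumes x: "x \<in> carrier (path_algebra G)"
  shows "\<one>\<^bsub>path_algebra G\<^esub> \<otimes>\<^bsub>path_algebra G\<^esub> x = x"
proof
  fix r
  \<comment> \<open>A trivial left factor must be the vertex at the end of \<open>r\<close>, so only
    one factorization contributes.\<close>
  have "(\<Sum>(p, q)\<in>splits r. (if p \<in> qpaths G \<and> parrows p = [] then 1 else 0) * x q) =
      (\<Sum>a\<in>splits r. if a = ((ptgt r, [], ptgt r), r) then x r else 0)"
    by (rule sum.cong)
      (auto elim!: splitsE simp: pconc_def composable_def qpaths_iff pre_digraph.cas.simps split: if_splits)
  also have "\<dots> = x r"
  proof (cases "r \<in> qpaths G")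
    case True
    then have "((ptgt r, [], ptgt r), r) \<in> splits r"
      by (intro splitsI) (auto simp: vertex_in_qpaths ptgt_in_verts composable_def intro: path_eqI)
    then show ?thesis by simp
  next
    case False
    then show ?thesis using x by (auto simp: path_algebra_simps intro!: sum.neutral)
  qed
  finally show "(\<one>\<^bsub>path_algebra G\<^esub> \<otimes>\<^bsub>path_algebra G\<^esub> x) r = x r"
    by (simp add: path_algebra_simps)
qed

lemma path_algebra_mult_one:
  fixes x :: "('a, 'b) qpath \<Rightarrow> 'k::field"
  assumes x: "x \<in> carrier (path_algebra G)"
  shows "x \<otimes>\<^bsub>path_algebra G\<^esub> \<one>\<^bsub>path_algebra G\<^esub> = x"
proof
  fix r
  have "(\<Sum>(p, q)\<in>splits r. x p * (if q \<in> qpaths G \<and> parrows q = [] then 1 else 0)) =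
      (\<Sum>a\<in>splits r. if a = (r, (psrc r, [], psrc r)) then x r else 0)"
    by (rule sum.cong)
      (auto elim!: splitsE simp: pconc_def composable_def qpaths_iff pre_digraph.cas.simps split: if_splits)
  also have "\<dots> = x r"
  proof (cases "r \<in> qpaths G")
    case True
    then have "(r, (psrc r, [], psrc r)) \<in> splits r"
      by (intro splitsI) (auto simp: vertex_in_qpaths qpaths_iff composable_def intro: path_eqI)
    then show ?thesis by simp
  next
    case False
    then show ?thesis using x by (auto simp: path_algebra_simps intro!: sum.neutral)
  qed
  finally show "(x \<otimes>\<^bsub>path_algebra G\<^esub> \<one>\<^bsub>path_algebra G\<^esub>) r = x r"
    by (simp add: path_algebra_simps)
qed

lemma path_algebra_one_closed: "\<one>\<^bsub>path_algebra G\<^esub> \<in> carrier (path_algebra G)"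
proof -
  have "{p \<in> qpaths G. parrows p = []} \<subseteq> (\<lambda>v. (v, [], v)) ` verts G"
    by (auto simp: qpaths_iff)
  then have "finite {p \<in> qpaths G. parrows p = []}"
    by (rule finite_subset) simp
  then show ?thesis
    by (auto simp: path_algebra_simps)
qed

lemma path_algebra_ring: "ring (path_algebra G :: ('k::field, ('a, 'b) qpath \<Rightarrow> 'k) module)"
  (is "ring ?R")
proof (rule ringI)
  have add_closed: "x \<oplus>\<^bsub>?R\<^esub> y \<in> carrier ?R" if "x \<in> carrier ?R" "y \<in> carrier ?R" for x y
  proof -
    have "{p. x p + y p \<noteq> 0} \<subseteq> {p. x p \<noteq> 0} \<union> {p. y p \<noteq> 0}" by auto
    with that show ?thesis
      by (auto simp: path_algebra_simps intro: finite_subset)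
  qed
  show "abelian_group ?R"
  proof (rule abelian_groupI)
    show "\<exists>y\<in>carrier ?R. y \<oplus>\<^bsub>?R\<^esub> x = \<zero>\<^bsub>?R\<^esub>" if "x \<in> carrier ?R" for x
      using that by (intro bexI[of _ "\<lambda>p. - x p"]) (auto simp: path_algebra_simps)
  qed (use add_closed in \<open>auto simp: path_algebra_simps ac_simps\<close>)
  show "Group.monoid ?R"
    by (rule monoidI) (simp_all add: path_algebra_mult_closed path_algebra_assoc
        path_algebra_one_mult path_algebra_mult_one path_algebra_one_closed)
qed (auto simp: path_algebra_simps split_def algebra_simps sum.distrib)

lemma mult_single:
  fixes c d :: "'k::field"
  assumes "p \<in> qpaths G" "q \<in> qpaths G" "composable p q"
  shows "(\<lambda>s. if s = p then c else 0) \<otimes>\<^bsub>path_algebra G\<^esub> (\<lambda>s. if s = q then d else 0) =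
    (\<lambda>s. if s = p \<cdot> q then c * d else 0)"
proof
  fix r
  have "(\<Sum>(a, b)\<in>splits r. (if a = p then c else 0) * (if b = q then d else 0)) =
      (\<Sum>ab\<in>splits r. if ab = (p, q) then c * d else 0)"
    by (rule sum.cong[OF refl]) (simp add: split_beta prod_eq_iff)
  also have "\<dots> = (if r = p \<cdot> q then c * d else 0)"
  proof -
    have "(p, q) \<in> splits r \<longleftrightarrow> r = p \<cdot> q"
      using assms by (auto simp: splits_def)
    then show ?thesis by simp
  qed
  finally show "((\<lambda>s. if s = p then c else 0) \<otimes>\<^bsub>path_algebra G\<^esub> (\<lambda>s. if s = q then d else 0)) r =
    (if r = p \<cdot> q then c * d else 0)"
    by (simp add: path_algebra_simps)
qed

end

section \<open>Coordinates on the monomial algebra\<close>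

locale monomial_quiver = fin_digraph Q
  for Q :: "('v, 'e) pre_digraph" +
  fixes Z :: "('v, 'e) qpath set"
    and A :: "('k::field, (('v, 'e) qpath \<Rightarrow> 'k) set) module"
  assumes relations: "monomial_relations Q Z"
    and A_def: "A = monomial_algebra Q Z"
begin

abbreviation B :: "('v, 'e) qpath set" where
  "B \<equiv> basis_paths Q Z"

abbreviation KQ :: "('k, ('v, 'e) qpath \<Rightarrow> 'k) module" where
  "KQ \<equiv> path_algebra Q"

sublocale KQ: ring KQ
  by (rule path_algebra_ring)

lemma basis_qpath: "p \<in> B \<Longrightarrow> p \<in> qpaths Q"
  by (simp add: basis_paths_def)

lemma relation_qpath: "z \<in> Z \<Longrightarrow> z \<in> qpaths Q"
  using relations by (auto simp: monomial_relations_def)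

lemma basis_pconcD:
  assumes "p \<cdot> q \<in> B" "p \<in> qpaths Q" "q \<in> qpaths Q" "composable p q"
  shows "p \<in> B" "q \<in> B"
  using assms subpath_pconc[of p q] by (auto simp: basis_paths_def)

lemma relation_not_basis: "z \<in> Z \<Longrightarrow> z \<notin> B"
proof -
  assume z: "z \<in> Z"
  then have "z \<in> qpaths Q" by (rule relation_qpath)
  then have "(ptgt z, [], ptgt z) \<in> qpaths Q" "(psrc z, [], psrc z) \<in> qpaths Q"
    by (auto intro: vertex_in_qpaths ptgt_in_verts simp: qpaths_iff)
  then have "subpath Q z z"
    unfolding subpath_def
    by (intro bexI[of _ "(ptgt z, [], ptgt z)"] bexI[of _ "(psrc z, [], psrc z)"])
      (auto simp: composable_def intro: path_eqI)
  with z show "z \<notin> B"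
    by (auto simp: basis_paths_def)
qed

section \<open>The ideal generated by the relations\<close>

text \<open>Explicit form of the ideal generated by \<open>Z\<close>, as
  \<open>Idl_relations\<close> confirms. It turns equality of cosets into equality of coefficients
  on \<open>B\<close>.\<close>

definition null :: "(('v, 'e) qpath \<Rightarrow> 'k) set" where
  "null = {x \<in> carrier KQ. \<forall>p\<in>B. x p = 0}"

lemma nullD:
  assumes "x \<in> null"
  shows "x \<in> carrier KQ" "p \<in> B \<Longrightarrow> x p = 0"
  using assms unfolding null_def by blast+

text \<open>Every factor of a basis path is a basis path. Hence the coefficients of a product on
  \<open>B\<close> depend only on those of the factors on \<open>B\<close>, which makes
  \<open>null\<close> a two-sided ideal.\<close>

lemma mult_apply_basis:
  assumes r: "r \<in> B"
  shows "(x \<otimes>\<^bsub>KQ\<^esub> y) r = (\<Sum>(p, q)\<in>splits r. x p * y q)" "splits r \<subseteq> B \<times> B"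
  using r by (auto simp: path_algebra_simps elim!: splitsE dest: basis_pconcD)

lemma null_ideal: "ideal null KQ"
proof (rule idealI)
  show "subgroup null (add_monoid KQ)"
  proof (rule KQ.add.subgroupI)
    show "null \<noteq> {}"
      using KQ.zero_closed by (auto simp: null_def path_algebra_simps)
    fix x assume x: "x \<in> null"
    then have inv: "\<ominus>\<^bsub>KQ\<^esub> x \<in> carrier KQ" "x \<oplus>\<^bsub>KQ\<^esub> \<ominus>\<^bsub>KQ\<^esub> x = \<zero>\<^bsub>KQ\<^esub>"
      by (auto simp: null_def KQ.r_neg)
    have "(\<ominus>\<^bsub>KQ\<^esub> x) p = 0" if "p \<in> B" for p
      using fun_cong[OF inv(2), of p] x that by (simp add: null_def path_algebra_apply)
    then show "\<ominus>\<^bsub>KQ\<^esub> x \<in> null"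
      using inv by (simp add: null_def)
    fix y assume "y \<in> null"
    with x show "x \<oplus>\<^bsub>KQ\<^esub> y \<in> null"
      using KQ.a_closed[of x y] by (simp add: null_def path_algebra_apply)
  qed (auto simp: null_def)
  fix a x assume a: "a \<in> null" and x: "x \<in> carrier KQ"
  show "x \<otimes>\<^bsub>KQ\<^esub> a \<in> null" "a \<otimes>\<^bsub>KQ\<^esub> x \<in> null"
  proof -
    have "(x \<otimes>\<^bsub>KQ\<^esub> a) r = 0" "(a \<otimes>\<^bsub>KQ\<^esub> x) r = 0" if "r \<in> B" for r
      using a mult_apply_basis[OF that] by (auto simp: null_def intro!: sum.neutral)
    then show "x \<otimes>\<^bsub>KQ\<^esub> a \<in> null" "a \<otimes>\<^bsub>KQ\<^esub> x \<in> null"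
      using a x KQ.m_closed by (auto simp: null_def)
  qed
qed (rule KQ.ring_axioms)

lemma single_closed: "p \<in> qpaths Q \<Longrightarrow> (\<lambda>q. if q = p then c else 0) \<in> carrier KQ"
  by (auto simp: path_algebra_simps(1))

lemma single_in_ideal:
  assumes I: "ideal I KQ" and Z: "path_element ` Z \<subseteq> I" and p: "p \<in> qpaths Q" "p \<notin> B"
  shows "(\<lambda>q. if q = p then c else 0) \<in> I"
proof -
  obtain z where z: "z \<in> Z" and "subpath Q z p"
    using p unfolding basis_paths_def by blast
  then obtain x y where xy: "x \<in> qpaths Q" "y \<in> qpaths Q" "composable x z" "composable z y"
      "p = x \<cdot> z \<cdot> y"
    unfolding subpath_def by blast
  let ?s = "\<lambda>c p q. if q = p then c else (0::'k)"
  have "?s 1 z \<in> I"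
    using z Z by (auto simp: path_element_def)
  \<comment> \<open>The scalar \<open>c\<close> is carried by the flank \<open>x\<close>, because
    closure of a ring ideal speaks of multiplication by ring elements.\<close>
  then have "?s c x \<otimes>\<^bsub>KQ\<^esub> ?s 1 z \<otimes>\<^bsub>KQ\<^esub> ?s 1 y \<in> I"
    using xy by (intro ideal.I_r_closed[OF I] ideal.I_l_closed[OF I] single_closed)
  also have "?s c x \<otimes>\<^bsub>KQ\<^esub> ?s 1 z \<otimes>\<^bsub>KQ\<^esub> ?s 1 y = ?s c p"
    using xy relation_qpath[OF z] by (simp add: mult_single pconc_in_qpaths cong: if_cong)
  finally show ?thesis .
qed

lemma null_subset_ideal:
  assumes I: "ideal I KQ" and Z: "path_element ` Z \<subseteq> I"
  shows "null \<subseteq> I"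
proof
  \<comment> \<open>Coefficients off \<open>B\<close> are removed one at a time; clearing the one at
    \<open>p\<close> leaves a function with support in \<open>F\<close>.\<close>
  have "x \<in> I" if "finite F" "F \<subseteq> qpaths Q - B" "{p. x p \<noteq> 0} \<subseteq> F" for F x
    using that
  proof (induction F arbitrary: x rule: finite_induct)
    case empty
    then have "x = \<zero>\<^bsub>KQ\<^esub>"
      by (simp add: fun_eq_iff path_algebra_apply)
    then show ?case
      using I by (simp add: additive_subgroup.zero_closed ideal.axioms(1))
  next
    case (insert p F)
    have "x(p := 0) \<in> I"
      using insert.prems by (intro insert.IH) auto
    moreover have "(\<lambda>q. if q = p then x p else 0) \<in> I"
      using insert.prems by (intro single_in_ideal[OF I Z]) auto
    ultimately have "x(p := 0) \<oplus>\<^bsub>KQ\<^esub> (\<lambda>q. if q = p then x p else 0) \<in> I"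
      using I by (simp add: additive_subgroup.a_closed ideal.axioms(1))
    also have "x(p := 0) \<oplus>\<^bsub>KQ\<^esub> (\<lambda>q. if q = p then x p else 0) = x"
      by (simp add: fun_eq_iff path_algebra_apply)
    finally show ?case .
  qed
  then show "x \<in> I" if "x \<in> null" for x
    using that by (elim meta_allE[of _ "{p. x p \<noteq> 0}"]) (auto simp: null_def path_algebra_simps(1))
qed

text \<open>\<open>null\<close> is an ideal containing the relations and is contained in every such
  ideal.\<close>

lemma Idl_relations: "Idl\<^bsub>KQ\<^esub> (path_element ` Z) = null"
proof
  have Z: "path_element ` Z \<subseteq> null"
    using single_closed[of _ 1] relation_qpath relation_not_basis
    by (auto simp: null_def path_element_def)
  then show "Idl\<^bsub>KQ\<^esub> (path_element ` Z) \<subseteq> null"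
    by (intro KQ.genideal_minimal null_ideal)
  have "path_element ` Z \<subseteq> carrier KQ"
    using Z by (auto simp: null_def)
  then show "null \<subseteq> Idl\<^bsub>KQ\<^esub> (path_element ` Z)"
    by (intro null_subset_ideal KQ.genideal_ideal KQ.genideal_self)
qed

section \<open>Cosets and their coordinates\<close>

definition cls :: "(('v, 'e) qpath \<Rightarrow> 'k) \<Rightarrow> (('v, 'e) qpath \<Rightarrow> 'k) set" where
  "cls x = null +>\<^bsub>KQ\<^esub> x"

lemma cls_eq:
  assumes x: "x \<in> carrier KQ"
  shows "cls x = {y \<in> carrier KQ. \<forall>p\<in>B. y p = x p}"
proof (intro subset_antisym subsetI)
  fix y assume "y \<in> cls x"
  then have "\<exists>i\<in>null. y = i \<oplus>\<^bsub>KQ\<^esub> x"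
    unfolding cls_def a_r_coset_def' by blast
  then obtain i where i: "i \<in> null" "y = i \<oplus>\<^bsub>KQ\<^esub> x" ..
  have "y \<in> carrier KQ"
    unfolding i(2) using nullD(1)[OF i(1)] x by (rule KQ.a_closed)
  moreover have "y p = x p" if "p \<in> B" for p
    unfolding i(2) path_algebra_apply nullD(2)[OF i(1) that] by (rule add_0)
  ultimately show "y \<in> {y \<in> carrier KQ. \<forall>p\<in>B. y p = x p}"
    by blast
next
  fix y assume y: "y \<in> {y \<in> carrier KQ. \<forall>p\<in>B. y p = x p}"
  let ?i = "\<lambda>p. y p - x p"
  have sub: "{p. ?i p \<noteq> 0} \<subseteq> {p. y p \<noteq> 0} \<union> {p. x p \<noteq> 0}" by auto
  then have "finite {p. ?i p \<noteq> 0}"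
    by (rule finite_subset) (use x y in \<open>simp add: path_algebra_simps(1)\<close>)
  moreover have "{p. ?i p \<noteq> 0} \<subseteq> qpaths Q"
    using sub x y unfolding path_algebra_simps(1) by blast
  ultimately have "?i \<in> null"
    using y by (simp add: null_def path_algebra_simps(1))
  then have "?i \<oplus>\<^bsub>KQ\<^esub> x \<in> cls x"
    by (auto simp: cls_def a_r_coset_def')
  moreover have "?i \<oplus>\<^bsub>KQ\<^esub> x = y"
    by (simp add: fun_eq_iff path_algebra_apply)
  ultimately show "y \<in> cls x"
    by (simp only:)
qed

lemma cls_cong:
  assumes "x \<in> carrier KQ" "y \<in> carrier KQ" "\<And>p. p \<in> B \<Longrightarrow> x p = y p"
  shows "cls x = cls y"
  unfolding cls_eq[OF assms(1)] cls_eq[OF assms(2)] using assms(3) by auto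

lemma
  shows carrier_A: "carrier A = cls ` carrier KQ"
    and mult_A: "\<lbrakk>x \<in> carrier KQ; y \<in> carrier KQ\<rbrakk> \<Longrightarrow> cls x \<otimes>\<^bsub>A\<^esub> cls y = cls (x \<otimes>\<^bsub>KQ\<^esub> y)"
    and add_A: "\<lbrakk>x \<in> carrier KQ; y \<in> carrier KQ\<rbrakk> \<Longrightarrow> cls x \<oplus>\<^bsub>A\<^esub> cls y = cls (x \<oplus>\<^bsub>KQ\<^esub> y)"
    and zero_A: "\<zero>\<^bsub>A\<^esub> = cls \<zero>\<^bsub>KQ\<^esub>"
proof -
  interpret null: ideal null KQ
    by (rule null_ideal)
  show "carrier A = cls ` carrier KQ"
    "\<lbrakk>x \<in> carrier KQ; y \<in> carrier KQ\<rbrakk> \<Longrightarrow> cls x \<otimes>\<^bsub>A\<^esub> cls y = cls (x \<otimes>\<^bsub>KQ\<^esub> y)"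
    "\<lbrakk>x \<in> carrier KQ; y \<in> carrier KQ\<rbrakk> \<Longrightarrow> cls x \<oplus>\<^bsub>A\<^esub> cls y = cls (x \<oplus>\<^bsub>KQ\<^esub> y)"
    "\<zero>\<^bsub>A\<^esub> = cls \<zero>\<^bsub>KQ\<^esub>"
    unfolding A_def monomial_algebra_def quotient_algebra_def Idl_relations
    by (auto simp: ring.defs module.defs FactRing_simps cls_def null.rcoset_mult_add null.a_rcos_sum
        KQ.a_coset_add_zero[OF null.a_subset])
qed

lemma smult_closed: "x \<in> carrier KQ \<Longrightarrow> c \<odot>\<^bsub>KQ\<^esub> x \<in> carrier KQ"
  by (auto simp: path_algebra_simps(1) path_algebra_apply elim!: rev_finite_subset)

text \<open>The scalar action on the quotient is a union of cosets over all representatives. Scaling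
  preserves agreement on \<open>B\<close>, so these cosets coincide.\<close>

lemma smult_A:
  assumes x: "x \<in> carrier KQ"
  shows "c \<odot>\<^bsub>A\<^esub> cls x = cls (c \<odot>\<^bsub>KQ\<^esub> x)"
proof -
  have union: "c \<odot>\<^bsub>A\<^esub> cls x = (\<Union>y\<in>cls x. cls (c \<odot>\<^bsub>KQ\<^esub> y))"
    unfolding A_def monomial_algebra_def quotient_algebra_def Idl_relations
    by (simp add: ring.defs module.defs cls_def)
  have class_eq: "cls (c \<odot>\<^bsub>KQ\<^esub> y) = cls (c \<odot>\<^bsub>KQ\<^esub> x)" if "y \<in> cls x" for y
  proof (rule cls_cong)
    have y: "y \<in> carrier KQ" and y_eq: "\<forall>p\<in>B. y p = x p"
      using that unfolding cls_eq[OF x] by blast+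
    show "c \<odot>\<^bsub>KQ\<^esub> y \<in> carrier KQ" "c \<odot>\<^bsub>KQ\<^esub> x \<in> carrier KQ"
      by (rule smult_closed, fact)+
    fix p assume "p \<in> B"
    with y_eq have "y p = x p" by blast
    then show "(c \<odot>\<^bsub>KQ\<^esub> y) p = (c \<odot>\<^bsub>KQ\<^esub> x) p"
      by (simp only: path_algebra_apply)
  qed
  show ?thesis
    unfolding union
  proof (rule UN_constant_eq)
    show "x \<in> cls x"
      using x by (simp add: cls_eq)
  qed (intro ballI class_eq)
qed

text \<open>Any representative may be chosen: by \<open>cls_eq\<close> all of them agree at
  \<open>p\<close> when \<open>p\<close> lies in \<open>B\<close>. Elsewhere the value carries no
  meaning.\<close>

definition coord :: "(('v, 'e) qpath \<Rightarrow> 'k) set \<Rightarrow> ('v, 'e) qpath \<Rightarrow> 'k" where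
  "coord X p = (SOME x. x \<in> X) p"

lemma coord_cls:
  assumes x: "x \<in> carrier KQ" and p: "p \<in> B"
  shows "coord (cls x) p = x p"
proof -
  have "x \<in> cls x"
    using x by (simp add: cls_eq)
  then have "(SOME y. y \<in> cls x) \<in> cls x"
    by (rule someI[of "\<lambda>y. y \<in> cls x"])
  moreover have "\<forall>y\<in>cls x. y p = x p"
    using cls_eq[OF x] p by blast
  ultimately show ?thesis
    unfolding coord_def by blast
qed

lemma A_ring: "ring A"
proof -
  interpret null: ideal null KQ
    by (rule null_ideal)
  interpret R: ring "KQ Quot null"
    by (rule null.quotient_is_ring)
  \<comment> \<open>Extending the record by a scalar action changes its type but none of the ring
    operations, so the axioms are transferred field by field.\<close>
  have eqs: "carrier A = carrier (KQ Quot null)" "mult A = mult (KQ Quot null)"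
    "add A = add (KQ Quot null)" "zero A = zero (KQ Quot null)" "one A = one (KQ Quot null)"
    unfolding A_def monomial_algebra_def quotient_algebra_def Idl_relations
    by (simp_all add: ring.defs module.defs)
  show ?thesis
  proof (rule ringI)
    show "abelian_group A"
      by (rule abelian_groupI)
        (use R.a_assoc R.a_comm R.l_neg R.a_inv_closed in \<open>auto simp: eqs\<close>)
    show "Group.monoid A"
      by (rule monoidI) (auto simp: eqs R.m_assoc)
  qed (auto simp: eqs R.l_distr R.r_distr)
qed

sublocale A: ring A
  by (rule A_ring)

lemma coord_add_A:
  "\<lbrakk>X \<in> carrier A; Y \<in> carrier A; p \<in> B\<rbrakk> \<Longrightarrow> coord (X \<oplus>\<^bsub>A\<^esub> Y) p = coord X p + coord Y p"
  using KQ.a_closed by (auto simp: carrier_A add_A coord_cls path_algebra_apply)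

lemma smult_closed_A: "X \<in> carrier A \<Longrightarrow> c \<odot>\<^bsub>A\<^esub> X \<in> carrier A"
  by (auto simp: carrier_A smult_A smult_closed)

lemma coord_smult_A:
  "\<lbrakk>X \<in> carrier A; p \<in> B\<rbrakk> \<Longrightarrow> coord (c \<odot>\<^bsub>A\<^esub> X) p = c * coord X p"
  using smult_closed by (auto simp: carrier_A smult_A coord_cls path_algebra_apply)

lemma coord_eqI_A:
  assumes "X \<in> carrier A" "Y \<in> carrier A" and eq: "\<And>p. p \<in> B \<Longrightarrow> coord X p = coord Y p"
  shows "X = Y"
proof -
  from assms obtain x y where xy: "x \<in> carrier KQ" "X = cls x" "y \<in> carrier KQ" "Y = cls y"
    by (auto simp: carrier_A)
  then have "x p = y p" if "p \<in> B" for p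
    using eq[OF that] that by (simp add: coord_cls)
  then show ?thesis
    unfolding xy(2,4) using xy(1,3) by (intro cls_cong)
qed

lemma finite_support:
  assumes "X \<in> carrier A"
  shows "finite {p \<in> B. coord X p \<noteq> 0}"
proof -
  from assms obtain x where x: "x \<in> carrier KQ" "X = cls x"
    by (auto simp: carrier_A)
  have "{p \<in> B. coord X p \<noteq> 0} \<subseteq> {p. x p \<noteq> 0}"
    unfolding x(2) using coord_cls[OF x(1)] by fastforce
  then show ?thesis
    by (rule finite_subset) (use x in \<open>simp add: path_algebra_simps(1)\<close>)
qed

text \<open>The class of a basis path \<open>p\<close> has coordinate 1 at \<open>p\<close>, so some
  member of a finite spanning set is nonzero there. Each member has finite support, and
  \<open>B\<close> is covered by these supports.\<close>

lemma finite_basis: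
  assumes "finite_dimensional A"
  shows "finite B"
proof -
  from assms obtain S where S: "finite S" "S \<subseteq> carrier A"
    and span: "\<And>X. X \<in> carrier A \<Longrightarrow> \<exists>c. X = (\<Oplus>\<^bsub>A\<^esub>s\<in>S. c s \<odot>\<^bsub>A\<^esub> s)"
    by (auto simp: finite_dimensional_def)
  have coord_zero: "coord \<zero>\<^bsub>A\<^esub> p = 0" if "p \<in> B" for p
    using that KQ.zero_closed by (simp add: zero_A coord_cls path_algebra_apply)
  have coord_sum: "coord (\<Oplus>\<^bsub>A\<^esub>s\<in>F. c s \<odot>\<^bsub>A\<^esub> s) p = 0"
    if "finite F" "F \<subseteq> S" "p \<in> B" "\<forall>s\<in>S. coord s p = 0" for F c p
    using that
  proof (induction F rule: finite_induct)
    case (insert s F)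
    then have "(\<lambda>s. c s \<odot>\<^bsub>A\<^esub> s) \<in> F \<rightarrow> carrier A" "s \<in> carrier A"
      using S by (auto intro: smult_closed_A)
    with insert show ?case
      by (simp add: coord_add_A coord_smult_A smult_closed_A)
  qed (simp add: coord_zero)
  have "B \<subseteq> (\<Union>s\<in>S. {p \<in> B. coord s p \<noteq> 0})"
  proof
    fix p assume p: "p \<in> B"
    let ?X = "cls (\<lambda>q. if q = p then 1 else 0)"
    have X: "?X \<in> carrier A" "coord ?X p = 1"
      using p single_closed[OF basis_qpath[OF p], of 1] by (auto simp: carrier_A coord_cls)
    then obtain c where "?X = (\<Oplus>\<^bsub>A\<^esub>s\<in>S. c s \<odot>\<^bsub>A\<^esub> s)"
      using span by blast
    with X coord_sum[OF S(1) subset_refl p, of c] p show "p \<in> (\<Union>s\<in>S. {p \<in> B. coord s p \<noteq> 0})"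
      by auto
  qed
  moreover have "finite (\<Union>s\<in>S. {p \<in> B. coord s p \<noteq> 0})"
    using S finite_support by auto
  ultimately show ?thesis
    by (rule finite_subset)
qed

definition struct_const :: "('v, 'e) qpath \<Rightarrow> ('v, 'e) qpath \<Rightarrow> ('v, 'e) qpath \<Rightarrow> 'k" where
  "struct_const p q r = of_bool (composable p q \<and> p \<cdot> q = r)"

lemma coord_mult_A:
  assumes "finite B" and "X \<in> carrier A" "Y \<in> carrier A" "r \<in> B"
  shows "coord (X \<otimes>\<^bsub>A\<^esub> Y) r = (\<Sum>p\<in>B. \<Sum>q\<in>B. struct_const p q r * coord X p * coord Y q)"
proof -
  from assms obtain x y where x: "x \<in> carrier KQ" "X = cls x" and y: "y \<in> carrier KQ" "Y = cls y"
    by (auto simp: carrier_A)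
  have "coord (X \<otimes>\<^bsub>A\<^esub> Y) r = (\<Sum>(p, q)\<in>splits r. x p * y q)"
    using assms(4) KQ.m_closed[OF x(1) y(1)]
    by (simp add: x y mult_A coord_cls path_algebra_simps(2))
  \<comment> \<open>Factorizations of a basis path use only basis paths, and all other pairs in
    \<open>B \<times> B\<close> have structure constant 0.\<close>
  also have "\<dots> = (\<Sum>(p, q)\<in>B \<times> B. struct_const p q r * x p * y q)"
    using assms(1) mult_apply_basis(2)[OF assms(4)] basis_qpath
    by (intro sum.mono_neutral_cong_left) (auto simp: splits_def struct_const_def simp del: split_paired_All)
  also have "\<dots> = (\<Sum>p\<in>B. \<Sum>q\<in>B. struct_const p q r * coord X p * coord Y q)"
    by (subst sum.cartesian_product[symmetric]) (simp add: x y coord_cls)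
  finally show ?thesis .
qed

lemma coord_surj_A:
  assumes "finite B"
  shows "\<exists>X\<in>carrier A. \<forall>p\<in>B. coord X p = h p"
proof -
  let ?x = "\<lambda>p. if p \<in> B then h p else 0"
  have "{p. ?x p \<noteq> 0} \<subseteq> B" by auto
  then have "?x \<in> carrier KQ"
    using finite_subset[OF _ assms] basis_qpath by (simp add: path_algebra_simps(1)) blast
  then show ?thesis
    by (intro bexI[of _ "cls ?x"]) (simp_all add: carrier_A coord_cls)
qed

lemma based_algebra: "finite_dimensional A \<Longrightarrow> based_algebra A B coord struct_const"
  by unfold_locales
    (simp_all add: finite_basis smult_closed_A coord_add_A coord_smult_A coord_mult_A coord_surj_A coord_eqI_A)

end

section \<open>Balance conditions for paths\<close>

locale fd_monomial_quiver = monomial_quiver Q Z A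
  for Q :: "('v, 'e) pre_digraph" and Z :: "('v, 'e) qpath set"
    and A :: "('k::field, (('v, 'e) qpath \<Rightarrow> 'k) set) module" +
  assumes finite_dim: "finite_dimensional A"
begin

sublocale A: based_algebra A B coord struct_const
  by (rule based_algebra[OF finite_dim])

lemma sum_struct_const_right:
  assumes "\<beta> \<in> B" "composable \<beta> q"
  shows "(\<Sum>\<beta>'\<in>B. struct_const \<beta>' q (\<beta> \<cdot> q) * F \<beta>') = F \<beta>"
proof -
  have "(\<Sum>\<beta>'\<in>B. struct_const \<beta>' q (\<beta> \<cdot> q) * F \<beta>') = (\<Sum>\<beta>'\<in>B. of_bool (\<beta>' = \<beta>) * F \<beta>')"
    using assms by (intro sum.cong refl arg_cong2[where f = "(*)"])
      (auto simp only: struct_const_def of_bool_eq_iff dest: pconc_cancel_right)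
  then show ?thesis
    using assms by simp
qed

lemma sum_struct_const_left:
  assumes "\<gamma> \<in> B" "composable q \<gamma>"
  shows "(\<Sum>\<gamma>'\<in>B. struct_const q \<gamma>' (q \<cdot> \<gamma>) * F \<gamma>') = F \<gamma>"
proof -
  have "(\<Sum>\<gamma>'\<in>B. struct_const q \<gamma>' (q \<cdot> \<gamma>) * F \<gamma>') = (\<Sum>\<gamma>'\<in>B. of_bool (\<gamma>' = \<gamma>) * F \<gamma>')"
    using assms by (intro sum.cong refl arg_cong2[where f = "(*)"])
      (auto simp only: struct_const_def of_bool_eq_iff dest: pconc_cancel_left)
  then show ?thesis
    using assms by simp
qed

text \<open>By cancellation each side of the balance equation is a single entry of \<open>c\<close>
  or 0. The three conditions are the cases where both \<delta> and \<alpha> factor through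
  \<open>q\<close>, only \<delta> does, and only \<alpha> does; if neither does, the equation reads
  0 = 0.\<close>

lemma balanced_iff:
  "A.balanced c q \<longleftrightarrow>
    (\<forall>\<gamma>\<in>B. \<forall>\<beta>\<in>B. composable q \<gamma> \<and> composable \<beta> q \<and> q \<cdot> \<gamma> \<in> B \<and> \<beta> \<cdot> q \<in> B \<longrightarrow>
      c (q \<cdot> \<gamma>) \<beta> = c \<gamma> (\<beta> \<cdot> q)) \<and>
    (\<forall>\<alpha>\<in>B. \<forall>\<beta>\<in>B. composable \<beta> q \<and> \<beta> \<cdot> q \<in> B \<and> c \<alpha> \<beta> \<noteq> 0 \<longrightarrow>
      (\<exists>\<gamma>\<in>B. composable q \<gamma> \<and> q \<cdot> \<gamma> = \<alpha>)) \<and>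
    (\<forall>\<gamma>\<in>B. \<forall>\<delta>\<in>B. composable q \<gamma> \<and> q \<cdot> \<gamma> \<in> B \<and> c \<gamma> \<delta> \<noteq> 0 \<longrightarrow>
      (\<exists>\<beta>\<in>B. composable \<beta> q \<and> \<beta> \<cdot> q = \<delta>))"
  (is "_ \<longleftrightarrow> ?shift \<and> ?left \<and> ?right")
proof -
  let ?L = "\<lambda>\<alpha> \<delta>. \<Sum>\<beta>\<in>B. struct_const \<beta> q \<delta> * c \<alpha> \<beta>"
    and ?R = "\<lambda>\<alpha> \<delta>. \<Sum>\<gamma>\<in>B. struct_const q \<gamma> \<alpha> * c \<gamma> \<delta>"
  have L: "?L \<alpha> (\<beta> \<cdot> q) = c \<alpha> \<beta>" if "\<beta> \<in> B" "composable \<beta> q" for \<alpha> \<beta>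
    by (rule sum_struct_const_right[OF that])
  have R: "?R (q \<cdot> \<gamma>) \<delta> = c \<gamma> \<delta>" if "\<gamma> \<in> B" "composable q \<gamma>" for \<gamma> \<delta>
    by (rule sum_struct_const_left[OF that])
  have L0: "?L \<alpha> \<delta> = 0" if "\<not> (\<exists>\<beta>\<in>B. composable \<beta> q \<and> \<beta> \<cdot> q = \<delta>)" for \<alpha> \<delta>
    using that by (intro sum.neutral ballI) (auto simp only: struct_const_def of_bool_def mult_zero_left split: if_splits)
  have R0: "?R \<alpha> \<delta> = 0" if "\<not> (\<exists>\<gamma>\<in>B. composable q \<gamma> \<and> q \<cdot> \<gamma> = \<alpha>)" for \<alpha> \<delta>
    using that by (intro sum.neutral ballI) (auto simp only: struct_const_def of_bool_def mult_zero_left split: if_splits)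
  show ?thesis
  proof
    assume "A.balanced c q"
    then have bal: "?L \<alpha> \<delta> = ?R \<alpha> \<delta>" if "\<alpha> \<in> B" "\<delta> \<in> B" for \<alpha> \<delta>
      using that unfolding A.balanced_def by blast
    show "?shift \<and> ?left \<and> ?right"
    proof (intro conjI ballI impI; elim conjE)
      fix \<gamma> \<beta> assume "\<gamma> \<in> B" "\<beta> \<in> B" "composable q \<gamma>" "composable \<beta> q" "q \<cdot> \<gamma> \<in> B" "\<beta> \<cdot> q \<in> B"
      then show "c (q \<cdot> \<gamma>) \<beta> = c \<gamma> (\<beta> \<cdot> q)"
        using bal[of "q \<cdot> \<gamma>" "\<beta> \<cdot> q"] L[of \<beta>] R[of \<gamma>] by (simp only:)
    next
      fix \<alpha> \<beta> assume *: "\<alpha> \<in> B" "\<beta> \<in> B" "composable \<beta> q" "\<beta> \<cdot> q \<in> B" "c \<alpha> \<beta> \<noteq> 0"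
      then have "?R \<alpha> (\<beta> \<cdot> q) \<noteq> 0"
        using bal[of \<alpha> "\<beta> \<cdot> q"] L[of \<beta> \<alpha>] by simp
      then show "\<exists>\<gamma>\<in>B. composable q \<gamma> \<and> q \<cdot> \<gamma> = \<alpha>"
        by (rule contrapos_np) (rule R0)
    next
      fix \<gamma> \<delta> assume *: "\<gamma> \<in> B" "\<delta> \<in> B" "composable q \<gamma>" "q \<cdot> \<gamma> \<in> B" "c \<gamma> \<delta> \<noteq> 0"
      then have "?L (q \<cdot> \<gamma>) \<delta> \<noteq> 0"
        using bal[of "q \<cdot> \<gamma>" \<delta>] R[of \<gamma> \<delta>] by simp
      then show "\<exists>\<beta>\<in>B. composable \<beta> q \<and> \<beta> \<cdot> q = \<delta>"
        by (rule contrapos_np) (rule L0)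
    qed
  next
    assume *: "?shift \<and> ?left \<and> ?right"
    show "A.balanced c q"
      unfolding A.balanced_def
    proof (intro ballI)
      fix \<alpha> \<delta> assume \<alpha>: "\<alpha> \<in> B" and \<delta>: "\<delta> \<in> B"
      show "?L \<alpha> \<delta> = ?R \<alpha> \<delta>"
      proof (cases "\<exists>\<beta>\<in>B. composable \<beta> q \<and> \<beta> \<cdot> q = \<delta>")
        case True
        then obtain \<beta> where \<beta>: "\<beta> \<in> B" "composable \<beta> q" "\<beta> \<cdot> q = \<delta>" by blast
        show ?thesis
        proof (cases "\<exists>\<gamma>\<in>B. composable q \<gamma> \<and> q \<cdot> \<gamma> = \<alpha>")
          case True
          then obtain \<gamma> where \<gamma>: "\<gamma> \<in> B" "composable q \<gamma>" "q \<cdot> \<gamma> = \<alpha>" by blast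
          have "?L \<alpha> \<delta> = c \<alpha> \<beta>" "?R \<alpha> \<delta> = c \<gamma> \<delta>"
            using L[OF \<beta>(1,2)] R[OF \<gamma>(1,2)] by (simp_all only: \<beta>(3) \<gamma>(3))
          moreover have "c \<alpha> \<beta> = c \<gamma> \<delta>"
            using * \<alpha> \<delta> \<beta> \<gamma> by blast
          ultimately show ?thesis by (simp only:)
        next
          case False
          then have "c \<alpha> \<beta> = 0"
            using * \<alpha> \<delta> \<beta> by blast
          then show ?thesis
            using L[OF \<beta>(1,2), of \<alpha>] R0[OF False, of \<delta>] by (simp only: \<beta>(3))
        qed
      next
        case no_\<beta>: False
        show ?thesis
        proof (cases "\<exists>\<gamma>\<in>B. composable q \<gamma> \<and> q \<cdot> \<gamma> = \<alpha>")
          case True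
          then obtain \<gamma> where \<gamma>: "\<gamma> \<in> B" "composable q \<gamma>" "q \<cdot> \<gamma> = \<alpha>" by blast
          then have "c \<gamma> \<delta> = 0"
            using * \<alpha> \<delta> no_\<beta> by blast
          then show ?thesis
            using R[OF \<gamma>(1,2), of \<delta>] L0[OF no_\<beta>, of \<alpha>] by (simp only: \<gamma>(3))
        next
          case False
          then show ?thesis
            using L0[OF no_\<beta>, of \<alpha>] R0[OF False, of \<delta>] by (simp only:)
        qed
      qed
    qed
  qed
qed

lemma
  assumes "A.balanced c q" "\<beta> \<in> B" "\<gamma> \<in> B"
  shows balanced_shift: "\<lbrakk>composable q \<gamma>; composable \<beta> q; q \<cdot> \<gamma> \<in> B; \<beta> \<cdot> q \<in> B\<rbrakk> \<Longrightarrow>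
      c (q \<cdot> \<gamma>) \<beta> = c \<gamma> (\<beta> \<cdot> q)"
    and balanced_left: "\<lbrakk>composable \<beta> q; \<beta> \<cdot> q \<in> B; c \<gamma> \<beta> \<noteq> 0\<rbrakk> \<Longrightarrow> \<exists>\<gamma>'\<in>B. composable q \<gamma>' \<and> q \<cdot> \<gamma>' = \<gamma>"
    and balanced_right: "\<lbrakk>composable q \<gamma>; q \<cdot> \<gamma> \<in> B; c \<gamma> \<beta> \<noteq> 0\<rbrakk> \<Longrightarrow> \<exists>\<beta>'\<in>B. composable \<beta>' q \<and> \<beta>' \<cdot> q = \<beta>"
  using assms unfolding balanced_iff by blast+

text \<open>The factors are moved across one at a time. Closure of \<open>B\<close> under factors
  keeps the intermediate paths in \<open>B\<close>, where the condition for the next factor can be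
  applied.\<close>

lemma balanced_pconc:
  assumes p: "p \<in> qpaths Q" and q: "q \<in> qpaths Q" and pq: "composable p q"
    and bal_p: "A.balanced c p" and bal_q: "A.balanced c q"
  shows "A.balanced c (p \<cdot> q)"
  unfolding balanced_iff
proof (intro conjI ballI impI; elim conjE)
  fix \<gamma> \<beta> assume \<gamma>: "\<gamma> \<in> B" "composable (p \<cdot> q) \<gamma>" "p \<cdot> q \<cdot> \<gamma> \<in> B"
    and \<beta>: "\<beta> \<in> B" "composable \<beta> (p \<cdot> q)" "\<beta> \<cdot> (p \<cdot> q) \<in> B"
  have q\<gamma>: "composable q \<gamma>" "q \<cdot> \<gamma> \<in> B" "p \<cdot> (q \<cdot> \<gamma>) \<in> B"
    using \<gamma> basis_pconcD(2)[of p "q \<cdot> \<gamma>"] p q pq basis_qpath[OF \<gamma>(1)]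
    by (simp_all add: pconc_assoc pconc_in_qpaths)
  have \<beta>p: "composable \<beta> p" "\<beta> \<cdot> p \<in> B" "\<beta> \<cdot> p \<cdot> q \<in> B"
    using \<beta> basis_pconcD(1)[of "\<beta> \<cdot> p" q] p q pq basis_qpath[OF \<beta>(1)]
    by (simp_all add: pconc_assoc pconc_in_qpaths)
  have "c (p \<cdot> (q \<cdot> \<gamma>)) \<beta> = c (q \<cdot> \<gamma>) (\<beta> \<cdot> p)"
    using balanced_shift[OF bal_p \<beta>(1) q\<gamma>(2)] q\<gamma> \<beta>p pq by simp
  also have "\<dots> = c \<gamma> (\<beta> \<cdot> p \<cdot> q)"
    using balanced_shift[OF bal_q \<beta>p(2) \<gamma>(1)] q\<gamma> \<beta>p pq by simp
  finally show "c (p \<cdot> q \<cdot> \<gamma>) \<beta> = c \<gamma> (\<beta> \<cdot> (p \<cdot> q))"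
    by (simp only: pconc_assoc)
next
  fix \<alpha> \<beta> assume \<alpha>: "\<alpha> \<in> B" and \<beta>: "\<beta> \<in> B" "composable \<beta> (p \<cdot> q)" "\<beta> \<cdot> (p \<cdot> q) \<in> B" "c \<alpha> \<beta> \<noteq> 0"
  have \<beta>p: "composable \<beta> p" "\<beta> \<cdot> p \<in> B" "\<beta> \<cdot> p \<cdot> q \<in> B"
    using \<beta> basis_pconcD(1)[of "\<beta> \<cdot> p" q] p q pq basis_qpath[OF \<beta>(1)]
    by (simp_all add: pconc_assoc pconc_in_qpaths)
  then obtain \<gamma>' where \<gamma>': "\<gamma>' \<in> B" "composable p \<gamma>'" "p \<cdot> \<gamma>' = \<alpha>"
    using balanced_left[OF bal_p \<beta>(1) \<alpha>] \<beta>(4) by blast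
  \<comment> \<open>Once \<open>p\<close> is split off \<alpha>, the shift moves it to \<beta>
    without changing the entry, and balance for \<open>q\<close> then splits \<gamma>'.\<close>
  then have "c \<gamma>' (\<beta> \<cdot> p) \<noteq> 0"
    using balanced_shift[OF bal_p \<beta>(1) \<gamma>'(1)] \<alpha> \<beta>p \<beta>(4) by simp
  then obtain \<gamma> where "\<gamma> \<in> B" "composable q \<gamma>" "q \<cdot> \<gamma> = \<gamma>'"
    using balanced_left[OF bal_q \<beta>p(2) \<gamma>'(1)] \<beta>p pq by auto
  with \<gamma>' show "\<exists>\<gamma>\<in>B. composable (p \<cdot> q) \<gamma> \<and> p \<cdot> q \<cdot> \<gamma> = \<alpha>"
    by (intro bexI[of _ \<gamma>]) (simp_all add: pconc_assoc)
next
  fix \<gamma> \<delta> assume \<gamma>: "\<gamma> \<in> B" "composable (p \<cdot> q) \<gamma>" "p \<cdot> q \<cdot> \<gamma> \<in> B" and \<delta>: "\<delta> \<in> B" "c \<gamma> \<delta> \<noteq> 0"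
  have q\<gamma>: "composable q \<gamma>" "q \<cdot> \<gamma> \<in> B" "p \<cdot> (q \<cdot> \<gamma>) \<in> B"
    using \<gamma> basis_pconcD(2)[of p "q \<cdot> \<gamma>"] p q pq basis_qpath[OF \<gamma>(1)]
    by (simp_all add: pconc_assoc pconc_in_qpaths)
  then obtain \<beta>' where \<beta>': "\<beta>' \<in> B" "composable \<beta>' q" "\<beta>' \<cdot> q = \<delta>"
    using balanced_right[OF bal_q \<delta>(1) \<gamma>(1)] \<delta>(2) by blast
  then have "c (q \<cdot> \<gamma>) \<beta>' \<noteq> 0"
    using balanced_shift[OF bal_q \<beta>'(1) \<gamma>(1)] \<delta> q\<gamma> by simp
  then obtain \<beta> where "\<beta> \<in> B" "composable \<beta> p" "\<beta> \<cdot> p = \<beta>'"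
    using balanced_right[OF bal_p \<beta>'(1) q\<gamma>(2)] q\<gamma> pq by auto
  with \<beta>' show "\<exists>\<beta>\<in>B. composable \<beta> (p \<cdot> q) \<and> \<beta> \<cdot> (p \<cdot> q) = \<delta>"
    by (intro bexI[of _ \<beta>]) (simp_all add: pconc_assoc[symmetric])
qed

section \<open>Balanced matrices and neat classes\<close>

lemma cyclic_pairs_iff:
  "(\<alpha>, \<beta>) \<in> cyclic_pairs Q Z \<longleftrightarrow> \<alpha> \<in> B \<and> \<beta> \<in> B \<and> ptgt \<beta> = psrc \<alpha> \<and> ptgt \<alpha> = psrc \<beta>"
  by (auto simp only: cyclic_pairs_def mem_Collect_eq case_prod_conv mem_Sigma_iff)

text \<open>The clauses of neatness visible to left equivariance, one from each of the two
  conditions. The remaining two are the same clauses for the flipped pair.\<close>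

definition half_neat :: "('v, 'e) qpath \<Rightarrow> ('v, 'e) qpath \<Rightarrow> bool" where
  "half_neat \<alpha> \<beta> \<longleftrightarrow> (\<forall>a\<in>arcs Q.
    (composable \<beta> (arrow Q a) \<and> \<beta> \<cdot> arrow Q a \<in> B \<longrightarrow> is_last_arrow a \<alpha>) \<and>
    (composable (arrow Q a) \<alpha> \<and> arrow Q a \<cdot> \<alpha> \<in> B \<longrightarrow> is_first_arrow a \<beta>))"

lemma neat_pair_iff:
  "neat_pair Q Z (\<alpha>, \<beta>) \<longleftrightarrow> (\<alpha>, \<beta>) \<in> cyclic_pairs Q Z \<and> half_neat \<alpha> \<beta> \<and> half_neat \<beta> \<alpha>"
  unfolding neat_pair_def half_neat_def prod.case by blast

lemma last_arrow_pconc: "is_last_arrow a (arrow Q a \<cdot> p)"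
  by (simp add: is_last_arrow_def)

lemma first_arrow_pconc: "is_first_arrow a (p \<cdot> arrow Q a)"
  by (simp add: is_first_arrow_def)

lemma balanced_support_half_neat:
  assumes bal: "\<And>q. q \<in> B \<Longrightarrow> A.balanced c q" and B: "\<alpha> \<in> B" "\<beta> \<in> B" and c: "c \<alpha> \<beta> \<noteq> 0"
  shows "ptgt \<alpha> = psrc \<beta>" "half_neat \<alpha> \<beta>"
proof -
  \<comment> \<open>The vertex at the source of \<beta> acts on \<beta> as an identity, so balance
    for it forces \<alpha> to end there. The other endpoint condition comes from the flipped
    pair.\<close>
  define v where "v = (psrc \<beta>, [] :: 'e list, psrc \<beta>)"
  have v: "v \<in> qpaths Q" "composable \<beta> v" "\<beta> \<cdot> v = \<beta>" "ptgt v = psrc \<beta>"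
    using basis_qpath[OF B(2)]
    by (auto intro: vertex_in_qpaths path_eqI simp: v_def qpaths_iff[of \<beta>] composable_def)
  then have "v \<in> B"
    using basis_pconcD(2)[of \<beta> v] B(2) basis_qpath[OF B(2)] by simp
  then obtain \<gamma> where "v \<cdot> \<gamma> = \<alpha>"
    using balanced_left[OF bal B(2,1) v(2)] v(3) B(2) c by metis
  then show "ptgt \<alpha> = psrc \<beta>"
    using v(4) ptgt_pconc by metis
  show "half_neat \<alpha> \<beta>"
    unfolding half_neat_def
  proof (intro ballI conjI impI; elim conjE)
    fix a assume a: "a \<in> arcs Q"
    {
      assume comp: "composable \<beta> (arrow Q a)" "\<beta> \<cdot> arrow Q a \<in> B"
      then have "arrow Q a \<in> B"
        using basis_pconcD(2) basis_qpath[OF B(2)] arrow_in_qpaths[OF a] by blast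
      then show "is_last_arrow a \<alpha>"
        using balanced_left[OF bal B(2,1) comp] c last_arrow_pconc by metis
    next
      assume comp: "composable (arrow Q a) \<alpha>" "arrow Q a \<cdot> \<alpha> \<in> B"
      then have "arrow Q a \<in> B"
        using basis_pconcD(1) basis_qpath[OF B(1)] arrow_in_qpaths[OF a] by blast
      then show "is_first_arrow a \<beta>"
        using balanced_right[OF bal B(2,1) comp] c first_arrow_pconc by metis
    }
  qed
qed

text \<open>The flip exchanges the two generating moves and reverses their direction.\<close>

lemma shift_swap: "shift Q Z x y \<Longrightarrow> shift Q Z (prod.swap y) (prod.swap x)"
proof (induction rule: shift.induct)
  case (1 a \<alpha> \<beta>)
  then show ?case
    using shift.intros(2)[of a Q \<beta> \<alpha> Z] by (simp add: cyclic_pairs_iff)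
next
  case (2 b \<alpha> \<beta>)
  then show ?case
    using shift.intros(1)[of b Q \<beta> \<alpha> Z] by (simp add: cyclic_pairs_iff)
qed

lemma shift_cyclic:
  assumes "shift Q Z x y"
  shows "x \<in> cyclic_pairs Q Z" "y \<in> cyclic_pairs Q Z"
  using assms by (auto elim: shift.cases)

section \<open>Support and invariance of antisymmetric balanced matrices\<close>

context
  fixes c :: "('v, 'e) qpath \<Rightarrow> ('v, 'e) qpath \<Rightarrow> 'k"
  assumes bal: "\<And>q. q \<in> B \<Longrightarrow> A.balanced c q"
    and alt: "\<And>\<alpha> \<beta>. \<lbrakk>\<alpha> \<in> B; \<beta> \<in> B\<rbrakk> \<Longrightarrow> c \<alpha> \<beta> = - c \<beta> \<alpha>"
begin

text \<open>Antisymmetry makes the flipped entry nonzero too, and each of the two entries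
  contributes one half of neatness.\<close>

lemma balanced_support_neat:
  assumes B: "\<alpha> \<in> B" "\<beta> \<in> B" and c: "c \<alpha> \<beta> \<noteq> 0"
  shows "neat_pair Q Z (\<alpha>, \<beta>)"
proof -
  have "c \<beta> \<alpha> \<noteq> 0"
    using c alt[OF B] by (metis neg_0_equal_iff_equal)
  then show ?thesis
    using balanced_support_half_neat[OF bal B c] balanced_support_half_neat[OF bal B(2,1)] B
    by (simp add: neat_pair_iff cyclic_pairs_iff)
qed

lemma balanced_shift_arrow:
  assumes a: "a \<in> arcs Q" "composable (arrow Q a) \<alpha>" "composable \<beta> (arrow Q a)"
    and cyc: "(arrow Q a \<cdot> \<alpha>, \<beta>) \<in> cyclic_pairs Q Z" "(\<alpha>, \<beta> \<cdot> arrow Q a) \<in> cyclic_pairs Q Z"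
  shows "c (arrow Q a \<cdot> \<alpha>) \<beta> = c \<alpha> (\<beta> \<cdot> arrow Q a)"
proof -
  have "\<alpha> \<in> B" "\<beta> \<in> B" "arrow Q a \<cdot> \<alpha> \<in> B" "\<beta> \<cdot> arrow Q a \<in> B"
    using cyc unfolding cyclic_pairs_iff by blast+
  moreover from this have "arrow Q a \<in> B"
    using basis_pconcD(1) basis_qpath arrow_in_qpaths[OF a(1)] a(2) by blast
  ultimately show ?thesis
    using balanced_shift[OF bal] a by blast
qed

text \<open>The first move is balance for an arrow. The second is the first one for flipped pairs,
  and antisymmetry changes the sign of both sides.\<close>

lemma shift_balanced_eq: "shift Q Z x y \<Longrightarrow> c (fst x) (snd x) = c (fst y) (snd y)"
proof (induction rule: shift.induct)
  case (1 a \<alpha> \<beta>)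
  then show ?case
    by (simp only: balanced_shift_arrow fst_conv snd_conv)
next
  case (2 b \<alpha> \<beta>)
  then have B: "\<alpha> \<cdot> arrow Q b \<in> B" "\<beta> \<in> B" "\<alpha> \<in> B" "arrow Q b \<cdot> \<beta> \<in> B"
    unfolding cyclic_pairs_iff by blast+
  have "c (arrow Q b \<cdot> \<beta>) \<alpha> = c \<beta> (\<alpha> \<cdot> arrow Q b)"
    using 2 by (intro balanced_shift_arrow) (simp_all add: cyclic_pairs_iff)
  then show ?case
    using alt[OF B(1,2)] alt[OF B(3,4)] by simp
qed

lemma equivclp_balanced_eq:
  assumes "equivclp (shift Q Z) x y"
  shows "c (fst x) (snd x) = c (fst y) (snd y)"
  using assms by (induction rule: equivclp_induct) (auto dest: shift_balanced_eq)

text \<open>The nonzero value spreads over the whole class, so every member lies in the support and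
  is neat.\<close>

lemma balanced_neat_class:
  assumes B: "\<alpha> \<in> B" "\<beta> \<in> B" and c: "c \<alpha> \<beta> \<noteq> 0"
  shows "\<exists>C\<in>neat_classes Q Z. (\<alpha>, \<beta>) \<in> C \<and> (\<forall>y\<in>C. c (fst y) (snd y) = c \<alpha> \<beta>)"
proof (intro bexI[of _ "cyclic_equiv Q Z `` {(\<alpha>, \<beta>)}"] conjI ballI)
  have cyc: "(\<alpha>, \<beta>) \<in> cyclic_pairs Q Z"
    using balanced_support_neat[OF B c] by (simp add: neat_pair_iff)
  then show "(\<alpha>, \<beta>) \<in> cyclic_equiv Q Z `` {(\<alpha>, \<beta>)}"
    by (simp add: cyclic_equiv_def)
  show const: "c (fst y) (snd y) = c \<alpha> \<beta>" if "y \<in> cyclic_equiv Q Z `` {(\<alpha>, \<beta>)}" for y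
    using that equivclp_balanced_eq[of "(\<alpha>, \<beta>)" y] by (simp add: cyclic_equiv_def)
  have "neat_pair Q Z y" if "y \<in> cyclic_equiv Q Z `` {(\<alpha>, \<beta>)}" for y
  proof -
    have "y \<in> cyclic_pairs Q Z"
      using that by (simp add: cyclic_equiv_def)
    then have "fst y \<in> B" "snd y \<in> B"
      by (cases y; simp add: cyclic_pairs_iff)+
    then show ?thesis
      using balanced_support_neat[of "fst y" "snd y"] const[OF that] c by simp
  qed
  then show "cyclic_equiv Q Z `` {(\<alpha>, \<beta>)} \<in> neat_classes Q Z"
    using cyc by (simp add: neat_classes_def quotientI)
qed

end

text \<open>Converse passage from combinatorics to balance, by induction on the arrows of
  \<open>q\<close>. Antisymmetry is not among the hypotheses, so indicator functions of classes are
  covered.\<close>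

lemma neat_balanced:
  assumes neat: "\<And>\<alpha> \<beta>. \<lbrakk>\<alpha> \<in> B; \<beta> \<in> B; c \<alpha> \<beta> \<noteq> 0\<rbrakk> \<Longrightarrow> neat_pair Q Z (\<alpha>, \<beta>)"
    and shift: "\<And>\<alpha> \<beta> \<alpha>' \<beta>'. shift Q Z (\<alpha>, \<beta>) (\<alpha>', \<beta>') \<Longrightarrow> c \<alpha> \<beta> = c \<alpha>' \<beta>'"
    and q: "q \<in> B"
  shows "A.balanced c q"
proof -
  have cyclic: "(\<alpha>, \<beta>) \<in> cyclic_pairs Q Z" and half: "half_neat \<alpha> \<beta>"
    if "\<alpha> \<in> B" "\<beta> \<in> B" "c \<alpha> \<beta> \<noteq> 0" for \<alpha> \<beta>
    using neat[OF that] unfolding neat_pair_iff by blast+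
  have vertex: "A.balanced c q" if "q \<in> qpaths Q" "parrows q = []" for q
  proof -
    have "psrc q = ptgt q"
      using that by (simp add: qpaths_iff)
    then have id: "composable q p \<Longrightarrow> q \<cdot> p = p" "composable p q \<Longrightarrow> p \<cdot> q = p" for p
      using that(2) by (auto simp: composable_def intro: path_eqI)
    show ?thesis
      unfolding balanced_iff
    proof (intro conjI ballI impI; elim conjE)
      fix \<alpha> \<beta> assume *: "\<alpha> \<in> B" "\<beta> \<in> B" "composable \<beta> q" "c \<alpha> \<beta> \<noteq> 0"
      then have "composable q \<alpha>"
        using cyclic[OF *(1,2,4)] \<open>psrc q = ptgt q\<close> by (simp add: cyclic_pairs_iff composable_def)
      then show "\<exists>\<gamma>\<in>B. composable q \<gamma> \<and> q \<cdot> \<gamma> = \<alpha>"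
        using * id by blast
    next
      fix \<gamma> \<delta> assume *: "\<gamma> \<in> B" "\<delta> \<in> B" "composable q \<gamma>" "c \<gamma> \<delta> \<noteq> 0"
      then have "composable \<delta> q"
        using cyclic[OF *(1,2,4)] \<open>psrc q = ptgt q\<close> by (simp add: cyclic_pairs_iff composable_def)
      then show "\<exists>\<beta>\<in>B. composable \<beta> q \<and> \<beta> \<cdot> q = \<delta>"
        using * id by blast
    qed (simp only: id)
  qed
  have arrow: "A.balanced c (arrow Q a)" if a: "a \<in> arcs Q" for a
    unfolding balanced_iff
  proof (intro conjI ballI impI; elim conjE)
    fix \<gamma> \<beta> assume *: "\<gamma> \<in> B" "\<beta> \<in> B" "composable (arrow Q a) \<gamma>" "composable \<beta> (arrow Q a)"
      "arrow Q a \<cdot> \<gamma> \<in> B" "\<beta> \<cdot> arrow Q a \<in> B"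
    show "c (arrow Q a \<cdot> \<gamma>) \<beta> = c \<gamma> (\<beta> \<cdot> arrow Q a)"
    \<comment> \<open>Balance also speaks of paths that do not close up to a cycle. In that case
      both entries lie outside the support, since no move relates them.\<close>
    proof (cases "ptgt \<beta> = psrc \<gamma>")
      case True
      with * have "(arrow Q a \<cdot> \<gamma>, \<beta>) \<in> cyclic_pairs Q Z" "(\<gamma>, \<beta> \<cdot> arrow Q a) \<in> cyclic_pairs Q Z"
        by (simp_all add: cyclic_pairs_iff composable_def)
      then show ?thesis
        using * a by (intro shift shift.intros(1))
    next
      case False
      then have "c (arrow Q a \<cdot> \<gamma>) \<beta> = 0" "c \<gamma> (\<beta> \<cdot> arrow Q a) = 0"
        using cyclic[OF *(5,2)] cyclic[OF *(1,6)] by (auto simp only: cyclic_pairs_iff psrc_pconc ptgt_pconc)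
      then show ?thesis by (simp only:)
    qed
  next
    fix \<alpha> \<beta> assume *: "\<alpha> \<in> B" "\<beta> \<in> B" "composable \<beta> (arrow Q a)" "\<beta> \<cdot> arrow Q a \<in> B" "c \<alpha> \<beta> \<noteq> 0"
    then have "is_last_arrow a \<alpha>"
      using half[OF *(1,2,5)] a unfolding half_neat_def by blast
    \<comment> \<open>Half-neatness supplies \<open>a\<close> as the last arrow of \<alpha>;
      removing it gives the required factor.\<close>
    then have "parrows \<alpha> = butlast (parrows \<alpha>) @ [a]"
      by (auto simp: is_last_arrow_def)
    then obtain \<gamma> where "\<gamma> \<in> qpaths Q" "composable (arrow Q a) \<gamma>" "\<alpha> = arrow Q a \<cdot> \<gamma>"
      using snoc_path[OF basis_qpath[OF *(1)]] by metis
    then show "\<exists>\<gamma>\<in>B. composable (arrow Q a) \<gamma> \<and> arrow Q a \<cdot> \<gamma> = \<alpha>"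
      using basis_pconcD(2) *(1) arrow_in_qpaths[OF a] by blast
  next
    fix \<gamma> \<delta> assume *: "\<gamma> \<in> B" "\<delta> \<in> B" "composable (arrow Q a) \<gamma>" "arrow Q a \<cdot> \<gamma> \<in> B" "c \<gamma> \<delta> \<noteq> 0"
    then have "is_first_arrow a \<delta>"
      using half[OF *(1,2,5)] a unfolding half_neat_def by blast
    then have "parrows \<delta> = a # tl (parrows \<delta>)"
      by (auto simp: is_first_arrow_def)
    then obtain \<beta> where "\<beta> \<in> qpaths Q" "composable \<beta> (arrow Q a)" "\<delta> = \<beta> \<cdot> arrow Q a"
      using Cons_path[OF basis_qpath[OF *(2)]] by metis
    then show "\<exists>\<beta>\<in>B. composable \<beta> (arrow Q a) \<and> \<beta> \<cdot> arrow Q a = \<delta>"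
      using basis_pconcD(1) *(2) arrow_in_qpaths[OF a] by blast
  qed
  have "A.balanced c q" if "q \<in> qpaths Q" "parrows q = w" for q w
    using that
  proof (induction w arbitrary: q)
    case Nil
    then show ?case by (rule vertex)
  next
    case (Cons a w)
    obtain q' where q': "q' \<in> qpaths Q" "a \<in> arcs Q" "composable q' (arrow Q a)" "q = q' \<cdot> arrow Q a"
      "parrows q' = w"
      by (rule Cons_path[OF Cons.prems])
    then show ?case
      unfolding q'(4) using Cons.IH arrow by (intro balanced_pconc arrow_in_qpaths)
  qed
  then show ?thesis
    using basis_qpath[OF q] by blast
qed

section \<open>Indicator functions of neat classes\<close>

lemma neat_class_nonempty: "C \<in> neat_classes Q Z \<Longrightarrow> C \<noteq> {}"
  by (auto simp: neat_classes_def cyclic_equiv_def elim!: quotientE)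

lemma neat_class_neat: "\<lbrakk>C \<in> neat_classes Q Z; x \<in> C\<rbrakk> \<Longrightarrow> neat_pair Q Z x"
  by (simp add: neat_classes_def)

lemma neat_class_shift:
  assumes C: "C \<in> neat_classes Q Z" and xy: "shift Q Z x y"
  shows "x \<in> C \<longleftrightarrow> y \<in> C"
proof -
  obtain z where z: "C = cyclic_equiv Q Z `` {z}" "z \<in> cyclic_pairs Q Z"
    using C by (auto simp: neat_classes_def elim: quotientE)
  have "equivclp (shift Q Z) x y" "equivclp (shift Q Z) y x"
    using xy by (auto intro: equivclp_sym)
  then have "equivclp (shift Q Z) z x \<longleftrightarrow> equivclp (shift Q Z) z y"
    by (blast intro: equivclp_trans)
  then show ?thesis
    using z shift_cyclic[OF xy] by (simp add: cyclic_equiv_def)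
qed

lemma swap_mem_flip_class: "prod.swap x \<in> flip_class C \<longleftrightarrow> x \<in> C"
  by (auto simp only: flip_class_def inj_image_mem_iff[OF inj_swap])

lemma mem_flip_class: "(\<alpha>, \<beta>) \<in> flip_class C \<longleftrightarrow> (\<beta>, \<alpha>) \<in> C"
  using swap_mem_flip_class[of "(\<beta>, \<alpha>)"] by simp

lemma flip_class_shift:
  assumes C: "C \<in> neat_classes Q Z" and xy: "shift Q Z (\<alpha>, \<beta>) (\<alpha>', \<beta>')"
  shows "(\<alpha>, \<beta>) \<in> flip_class C \<longleftrightarrow> (\<alpha>', \<beta>') \<in> flip_class C"
  using neat_class_shift[OF C shift_swap[OF xy]] by (simp add: mem_flip_class)

text \<open>For the flipped class, the hypotheses of \<open>neat_balanced\<close> are read off from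
  members of \<open>C\<close>: neatness is symmetric in the pair, and \<open>shift_swap\<close>
  carries the moves over.\<close>

lemma neat_class_flip_diff_balanced:
  assumes C: "C \<in> neat_classes Q Z" and q: "q \<in> B"
  shows "A.balanced (\<lambda>\<alpha> \<beta>. of_bool ((\<alpha>, \<beta>) \<in> C)) q"
    and "A.balanced (\<lambda>\<alpha> \<beta>. of_bool ((\<alpha>, \<beta>) \<in> C) - of_bool ((\<alpha>, \<beta>) \<in> flip_class C)) q"
proof -
  show "A.balanced (\<lambda>\<alpha> \<beta>. of_bool ((\<alpha>, \<beta>) \<in> C)) q"
  proof (rule neat_balanced[OF _ _ q])
    show "neat_pair Q Z (\<alpha>, \<beta>)" if "of_bool ((\<alpha>, \<beta>) \<in> C) \<noteq> (0::'k)" for \<alpha> \<beta>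
      using that neat_class_neat[OF C] by (simp split: if_splits)
    show "(of_bool ((\<alpha>, \<beta>) \<in> C) :: 'k) = of_bool ((\<alpha>', \<beta>') \<in> C)"
      if "shift Q Z (\<alpha>, \<beta>) (\<alpha>', \<beta>')" for \<alpha> \<beta> \<alpha>' \<beta>'
      using neat_class_shift[OF C that] by (simp only:)
  qed
  show "A.balanced (\<lambda>\<alpha> \<beta>. of_bool ((\<alpha>, \<beta>) \<in> C) - of_bool ((\<alpha>, \<beta>) \<in> flip_class C)) q"
  proof (rule neat_balanced[OF _ _ q])
    show "neat_pair Q Z (\<alpha>, \<beta>)"
      if "of_bool ((\<alpha>, \<beta>) \<in> C) - of_bool ((\<alpha>, \<beta>) \<in> flip_class C) \<noteq> (0::'k)" for \<alpha> \<beta>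
    proof -
      have "(\<alpha>, \<beta>) \<in> C \<or> (\<beta>, \<alpha>) \<in> C"
        using that by (auto simp only: mem_flip_class of_bool_def diff_self split: if_splits)
      then have "neat_pair Q Z (\<alpha>, \<beta>) \<or> neat_pair Q Z (\<beta>, \<alpha>)"
        using neat_class_neat[OF C] by blast
      then show ?thesis
        by (auto simp only: neat_pair_iff cyclic_pairs_iff)
    qed
    show "(of_bool ((\<alpha>, \<beta>) \<in> C) - of_bool ((\<alpha>, \<beta>) \<in> flip_class C) :: 'k) =
        of_bool ((\<alpha>', \<beta>') \<in> C) - of_bool ((\<alpha>', \<beta>') \<in> flip_class C)"
      if "shift Q Z (\<alpha>, \<beta>) (\<alpha>', \<beta>')" for \<alpha> \<beta> \<alpha>' \<beta>'
      using neat_class_shift[OF C that] flip_class_shift[OF C that] by (simp only:)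
  qed
qed

lemma neat_class_subset: "C \<in> neat_classes Q Z \<Longrightarrow> (\<alpha>, \<beta>) \<in> C \<Longrightarrow> \<alpha> \<in> B \<and> \<beta> \<in> B"
  using neat_class_neat[of C "(\<alpha>, \<beta>)"] unfolding neat_pair_iff cyclic_pairs_iff by blast

text \<open>Valid in every characteristic: the difference of the two indicators is antisymmetric,
  and it vanishes only if they agree, as 0 and 1 differ in a field.\<close>

lemma Alt_trivial_flip:
  assumes Alt: "Alt A = {zero_hom A}" and C: "C \<in> neat_classes Q Z"
  shows "flip_class C = C"
proof -
  let ?c = "\<lambda>\<alpha> \<beta>. of_bool ((\<alpha>, \<beta>) \<in> C) - of_bool ((\<alpha>, \<beta>) \<in> flip_class C) :: 'k"
  have "?c \<alpha> \<beta> + ?c \<beta> \<alpha> = 0" for \<alpha> \<beta>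
    by (simp add: mem_flip_class)
  then have zero: "?c \<alpha> \<beta> = 0" if "\<alpha> \<in> B" "\<beta> \<in> B" for \<alpha> \<beta>
    using Alt that neat_class_flip_diff_balanced(2)[OF C] unfolding A.Alt_trivial_iff by blast
  have "(\<alpha>, \<beta>) \<in> C \<longleftrightarrow> (\<beta>, \<alpha>) \<in> C" for \<alpha> \<beta>
    using zero[of \<alpha> \<beta>] neat_class_subset[OF C, of \<alpha> \<beta>] neat_class_subset[OF C, of \<beta> \<alpha>]
    unfolding mem_flip_class by (auto simp: of_bool_def split: if_splits)
  then have "x \<in> flip_class C \<longleftrightarrow> x \<in> C" for x
    by (cases x) (simp only: mem_flip_class)
  then show ?thesis by blast
qed

lemma Alt_trivial_iff_flip:
  assumes two: "(2::'k) \<noteq> 0"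
  shows "Alt A = {zero_hom A} \<longleftrightarrow> (\<forall>C\<in>neat_classes Q Z. flip_class C = C)"
proof
  assume flip: "\<forall>C\<in>neat_classes Q Z. flip_class C = C"
  show "Alt A = {zero_hom A}"
    unfolding A.Alt_trivial_iff
  proof (intro allI impI ballI; elim conjE)
    fix c \<alpha> \<beta>
    assume bal: "\<forall>q\<in>B. A.balanced c q" and alt: "\<forall>\<alpha>\<in>B. \<forall>\<beta>\<in>B. c \<alpha> \<beta> + c \<beta> \<alpha> = 0"
      and B: "\<alpha> \<in> B" "\<beta> \<in> B"
    show "c \<alpha> \<beta> = 0"
    proof (rule ccontr)
      assume c: "c \<alpha> \<beta> \<noteq> 0"
      have "c \<alpha> \<beta> = - c \<beta> \<alpha>" if "\<alpha> \<in> B" "\<beta> \<in> B" for \<alpha> \<beta>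
        using alt that by (simp add: eq_neg_iff_add_eq_0)
      then obtain C where C: "C \<in> neat_classes Q Z" "(\<alpha>, \<beta>) \<in> C"
        and const: "\<forall>y\<in>C. c (fst y) (snd y) = c \<alpha> \<beta>"
        using balanced_neat_class[of c \<alpha> \<beta>] bal B c by blast
      \<comment> \<open>The class contains the pair and its flip, so their entries are both equal
        and opposite; this contradicts invertibility of 2.\<close>
      have "(\<beta>, \<alpha>) \<in> C"
        using flip C mem_flip_class by blast
      then have "c \<beta> \<alpha> = c \<alpha> \<beta>"
        using const by fastforce
      then have "2 * c \<alpha> \<beta> = 0"
        using alt B by (metis mult_2)
      with two c show False by simp
    qed
  qed
qed (use Alt_trivial_flip in blast)

lemma Alt_trivial_iff_no_neat_class:
  assumes two: "(2::'k) = 0"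
  shows "Alt A = {zero_hom A} \<longleftrightarrow> neat_classes Q Z = {}"
proof
  assume Alt: "Alt A = {zero_hom A}"
  have False if C: "C \<in> neat_classes Q Z" for C
  proof -
    let ?c = "\<lambda>\<alpha> \<beta>. of_bool ((\<alpha>, \<beta>) \<in> C) :: 'k"
    \<comment> \<open>A neat class must already be its own flip, so its indicator is symmetric.
      Symmetric and antisymmetric agree when 2 = 0, and the indicator itself becomes a nonzero
      alternating matrix.\<close>
    have "(\<alpha>, \<beta>) \<in> C \<longleftrightarrow> (\<beta>, \<alpha>) \<in> C" for \<alpha> \<beta>
      using Alt_trivial_flip[OF Alt C] mem_flip_class by blast
    then have "?c \<alpha> \<beta> + ?c \<beta> \<alpha> = 2 * ?c \<alpha> \<beta>" for \<alpha> \<beta>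
      by (simp only: mult_2)
    then have "?c \<alpha> \<beta> + ?c \<beta> \<alpha> = 0" for \<alpha> \<beta>
      by (simp only: two mult_zero_left)
    then have zero: "?c \<alpha> \<beta> = 0" if "\<alpha> \<in> B" "\<beta> \<in> B" for \<alpha> \<beta>
      using Alt that neat_class_flip_diff_balanced(1)[OF C] unfolding A.Alt_trivial_iff by blast
    obtain \<alpha> \<beta> where "(\<alpha>, \<beta>) \<in> C"
      using neat_class_nonempty[OF C] by (metis ex_in_conv surj_pair)
    then show False
      using zero[of \<alpha> \<beta>] neat_class_subset[OF C] by auto
  qed
  then show "neat_classes Q Z = {}" by blast
next
  assume empty: "neat_classes Q Z = {}"
  show "Alt A = {zero_hom A}"
    unfolding A.Alt_trivial_iff
  proof (intro allI impI ballI; elim conjE)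
    fix c \<alpha> \<beta>
    assume bal: "\<forall>q\<in>B. A.balanced c q" and alt: "\<forall>\<alpha>\<in>B. \<forall>\<beta>\<in>B. c \<alpha> \<beta> + c \<beta> \<alpha> = 0"
      and B: "\<alpha> \<in> B" "\<beta> \<in> B"
    have "c \<alpha> \<beta> = - c \<beta> \<alpha>" if "\<alpha> \<in> B" "\<beta> \<in> B" for \<alpha> \<beta>
      using alt that by (simp add: eq_neg_iff_add_eq_0)
    then show "c \<alpha> \<beta> = 0"
      using balanced_neat_class[of c \<alpha> \<beta>] bal B empty by blast
  qed
qed

end

text \<open>A characteristic dividing 2 is 1 or 2, and 1 is excluded in a field.\<close>

lemma two_eq_zero_iff_CHAR: "(2::'k::field) = 0 \<longleftrightarrow> CHAR('k) = 2"
proof -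
  have "(2::'k) = 0 \<longleftrightarrow> CHAR('k) dvd 2"
    using of_nat_eq_0_iff_char_dvd[where 'a = 'k, of 2] by simp
  also have "\<dots> \<longleftrightarrow> CHAR('k) = 2"
  proof
    assume dvd: "CHAR('k) dvd 2"
    then have "CHAR('k) \<le> 2"
      by (rule dvd_imp_le) simp
    moreover have "CHAR('k) \<noteq> 0"
      using dvd by (metis dvd_0_left_iff zero_neq_numeral)
    ultimately show "CHAR('k) = 2"
      using CHAR_not_1'[where 'a = 'k] by linarith
  qed simp
  finally show ?thesis .
qed

theorem corollary4p8:
  fixes Q :: "('v, 'e) pre_digraph"
    and Z :: "('v, 'e) qpath set"
    and A :: "('k::field, (('v, 'e) qpath \<Rightarrow> 'k) set) module"
  assumes "fin_digraph Q"
    and "Digraph_Component.connected Q"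
    and "monomial_relations Q Z"
    and A_def: "A = monomial_algebra Q Z"
    and "finite_dimensional A"
  shows "(CHAR('k) \<noteq> 2 \<longrightarrow>
            (Alt A = {zero_hom A} \<longleftrightarrow> (\<forall>C\<in>neat_classes Q Z. flip_class C = C)))
       \<and> (CHAR('k) = 2 \<longrightarrow>
            (Alt A = {zero_hom A} \<longleftrightarrow> neat_classes Q Z = {}))"
proof -
  interpret fd_monomial_quiver Q Z A
    using assms by (intro fd_monomial_quiver.intro monomial_quiver.intro monomial_quiver_axioms.intro
        fd_monomial_quiver_axioms.intro)
  show ?thesis
    using Alt_trivial_iff_flip Alt_trivial_iff_no_neat_class unfolding two_eq_zero_iff_CHAR by blast
qed

end
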